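(* (a) Let $g$ lie in $\mathcal{C}^1\cap\mathcal{D}^p\cap\mathcal{K}^{\max\{p,1\}}$ for some $p\in\mathbb{N}$. Then, for any $m\in\mathbb{N}^*$ and any $x>0$, $$\frac1m\sum_{j=0}^{m-1}\Sigma g\left(x+\frac jm\right)=\int_x^{x+1}\Sigma g(t)\,dt-\frac1{2m}\,g(x)+R_m(x),$$ with $$R_m(x)=\frac1m\int_0^1B_1(\{mt\})\,(\Sigma g)'(x+t)\,dt\qquad\text{and}\qquad|R_m(x)|\le\frac1{2m}\int_0^1|(\Sigma g)'(x+t)|\,dt.$$ For large $x$ the latter integral $\int_0^1|(\Sigma g)'(x+t)|\,dt$ reduces to $|g(x)|$. (b) Let $g$ lie in $\mathcal{C}^{2q}\cap\mathcal{D}^p\cap\mathcal{K}^{\max\{p,2q\}}$ for some $p\in\mathbb{N}$ and some $q\in\mathbb{N}^*$. Then, for any $m\in\mathbb{N}^*$ and any $x>0$, $$\frac1m\sum_{j=0}^{m-1}\Sigma g\left(x+\frac jm\right)=\int_x^{x+1}\Sigma g(t)\,dt-\frac1{2m}\,g(x)+\sum_{k=1}^q\frac1{m^{2k}}\frac{B_{2k}}{(2k)!}\,g^{(2k-1)}(x)+R^q_m(x),$$ with $$R^q_m(x)=-\frac1{m^{2q}}\int_0^1\frac{B_{2q}(\{mt\})}{(2q)!}\,(\Sigma g)^{(2q)}(x+t)\,dt\quad\text{and}\quad|R^q_m(x)|\le\frac1{m^{2q}}\frac{|B_{2q}|}{(2q)!}\int_0^1|(\Sigma g)^{(2q)}(x+t)|\,dt.$$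 For large $x$ the latter integral $\int_0^1|(\Sigma g)^{(2q)}(x+t)|\,dt$ reduces to $|g^{(2q-1)}(x)|$.
   Context: $\mathbb{N}=\{0,1,2,\ldots\}$, $\mathbb{N}^*=\{1,2,\ldots\}$, $\mathbb{R}_+=(0,\infty)$, $\Delta f(x)=f(x+1)-f(x)$; $\{x\}=x-\lfloor x\rfloor$ is the fractional part; $\mathcal{C}^r$ is the set of $r$ times continuously differentiable functions $\mathbb{R}_+\to\mathbb{R}$. $B_n$ are the Bernoulli numbers ($\sum_{j=0}^m\binom{m+1}{j}B_j=0^m$ for $m\in\mathbb{N}$, so $B_0=1$, $B_1=-\frac12$), and $B_n(x)=\sum_{k=0}^n\binom nk B_{n-k}x^k$ are the Bernoulli polynomials. For an integer $p\ge -1$, a function $f\colon I\to\mathbb{R}$ on a real interval $I$ is $p$-convex (resp. $p$-concave) if for all $x_0<\cdots<x_{p+1}$ in $I$ the divided difference $f[x_0,\ldots,x_{p+1}]$ is $\ge 0$ (resp. $\le 0$), where $f[x_0,\ldots,x_n]=\sum_{k=0}^n f(x_k)/\prod_{j\ne k}(x_k-x_j)$. $\mathcal{K}^p$ is the set of functions $\mathbb{R}_+\to\mathbb{R}$ that are $p$-convex on some $[a,\infty)$ or $p$-concave on some $[a,\infty)$ (and $\mathcal{K}^{p+1}\subset\mathcal{K}^p$). $\mathcal{D}^p$ is the set of $g\colon\mathbb{R}_+\to\mathbb{R}$ with $\Delta^pg(n)\to 0$ as $n\to\infty$ over the integers. For $g\in\mathcal{D}^p\cap\mathcal{K}^p$,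 the function $\Sigma g\colon\mathbb{R}_+\to\mathbb{R}$ is $$\Sigma g(x)=\lim_{n\to\infty}\Big(-g(x)+\sum_{k=1}^{n-1}(g(k)-g(x+k))+\sum_{j=1}^p\binom{x}{j}\Delta^{j-1}g(n)\Big);$$ the limit exists, does not depend on the choice of such $p$, and $\Sigma g$ is the unique solution $f\in\mathcal{K}^p$ of $\Delta f=g$ with $f(1)=0$. If moreover $g\in\mathcal{C}^r\cap\mathcal{K}^{\max\{p,r\}}$, then $\Sigma g\in\mathcal{C}^r$. *)

theory Defs
  imports "HOL-Analysis.Analysis"
begin

text \<open>
  Functions from the positive reals to the reals are represented by total functions on
  \<^typ>\<open>real\<close>.  Their values outside \<open>{0<..}\<close> affect neither membership in the classes below nor
  the values of \<open>Sigma_fun g\<close> and of the derivatives \<open>(deriv ^^ k) g\<close> at positive arguments.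
\<close>

definition fwd_diff :: "(real \<Rightarrow> real) \<Rightarrow> real \<Rightarrow> real" where
  "fwd_diff f = (\<lambda>x. f (x + 1) - f x)"

definition divided_difference :: "(real \<Rightarrow> real) \<Rightarrow> nat \<Rightarrow> (nat \<Rightarrow> real) \<Rightarrow> real" where
  "divided_difference f n X = (\<Sum>k\<le>n. f (X k) / (\<Prod>j\<in>{..n} - {k}. X k - X j))"

definition convex_of_order :: "nat \<Rightarrow> real set \<Rightarrow> (real \<Rightarrow> real) \<Rightarrow> bool" where
  "convex_of_order p I f \<longleftrightarrow>
     (\<forall>X. strict_mono_on {..p + 1} X \<and> X ` {..p + 1} \<subseteq> I \<longrightarrow> divided_difference f (p + 1) X \<ge> 0)"

definition concave_of_order :: "nat \<Rightarrow> real set \<Rightarrow> (real \<Rightarrow> real) \<Rightarrow> bool" where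
  "concave_of_order p I f \<longleftrightarrow>
     (\<forall>X. strict_mono_on {..p + 1} X \<and> X ` {..p + 1} \<subseteq> I \<longrightarrow> divided_difference f (p + 1) X \<le> 0)"

definition K_class :: "nat \<Rightarrow> (real \<Rightarrow> real) set" where
  "K_class p = {f. \<exists>a>0. convex_of_order p {a..} f \<or> concave_of_order p {a..} f}"

definition D_class :: "nat \<Rightarrow> (real \<Rightarrow> real) set" where
  "D_class p = {g. (\<lambda>n::nat. (fwd_diff ^^ p) g (real n)) \<longlonglongrightarrow> 0}"

definition C_class :: "nat \<Rightarrow> (real \<Rightarrow> real) set" where
  "C_class r = {f. (\<forall>k<r. \<forall>x>0. (deriv ^^ k) f field_differentiable at x) \<and>
                   continuous_on {0<..} ((deriv ^^ r) f)}"

definition Sigma_approx :: "nat \<Rightarrow> (real \<Rightarrow> real) \<Rightarrow> real \<Rightarrow> nat \<Rightarrow> real" where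
  "Sigma_approx p g x n =
     - g x + (\<Sum>k=1..<n. g (real k) - g (x + real k))
           + (\<Sum>j=1..p. (x gchoose j) * (fwd_diff ^^ (j - 1)) g (real n))"

text \<open>
  The limit is the same for every \<open>p\<close> with \<open>g \<in> D_class p \<inter> K_class p\<close> (lemma \<open>Sigma_fun_eq\<close>
  below), so fixing the least such \<open>p\<close> is only a way of choosing one.
\<close>

definition Sigma_fun :: "(real \<Rightarrow> real) \<Rightarrow> real \<Rightarrow> real" where
  "Sigma_fun g x = lim (Sigma_approx (LEAST p. g \<in> D_class p \<inter> K_class p) g x)"

lemma D_class_mono:
  assumes "g \<in> D_class p" "p \<le> p'"
  shows "g \<in> D_class p'"
  using assms(2,1)
proof (induction p' rule: dec_induct)
  case base
  then show ?case by simp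
next
  case (step k)
  then have 1: "(\<lambda>n::nat. (fwd_diff ^^ k) g (real n)) \<longlonglongrightarrow> 0"
    by (simp add: D_class_def)
  have "(\<lambda>n::nat. (fwd_diff ^^ k) g (real (Suc n)) - (fwd_diff ^^ k) g (real n)) \<longlonglongrightarrow> 0 - 0"
    by (intro tendsto_diff 1 LIMSEQ_Suc[OF 1])
  then show ?case
    by (simp add: D_class_def fwd_diff_def[of "(fwd_diff ^^ k) g"] add.commute)
qed

lemma Sigma_fun_eq:
  assumes "g \<in> D_class p \<inter> K_class p"
  shows "Sigma_fun g x = lim (Sigma_approx p g x)"
proof -
  define p0 where "p0 = (LEAST p. g \<in> D_class p \<inter> K_class p)"
  have p0: "g \<in> D_class p0 \<inter> K_class p0"
    unfolding p0_def by (rule LeastI[of _ p]) (rule assms)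
  have le: "p0 \<le> p"
    unfolding p0_def by (rule Least_le) (rule assms)
  define r where "r = (\<lambda>n. \<Sum>j=p0+1..p. (x gchoose j) * (fwd_diff ^^ (j - 1)) g (real n))"
  have eq: "Sigma_approx p g x n = Sigma_approx p0 g x n + r n" for n
  proof -
    have "{1..p} = {1..p0} \<union> {p0+1..p}" "{1..p0} \<inter> {p0+1..p} = {}"
      using le by auto
    then show ?thesis
      unfolding Sigma_approx_def r_def by (simp add: sum.union_disjoint)
  qed
  have "(\<lambda>n. (x gchoose j) * (fwd_diff ^^ (j - 1)) g (real n)) \<longlonglongrightarrow> 0" if "j \<in> {p0+1..p}" for j
    using D_class_mono[of g p0 "j - 1"] p0 that
    by (intro tendsto_mult_right_zero) (auto simp: D_class_def)
  then have r: "r \<longlonglongrightarrow> 0"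
    unfolding r_def by (rule tendsto_null_sum)
  have "Sigma_approx p g x \<longlonglongrightarrow> l \<longleftrightarrow> Sigma_approx p0 g x \<longlonglongrightarrow> l" for l
  proof
    assume "Sigma_approx p g x \<longlonglongrightarrow> l"
    from tendsto_diff[OF this r] show "Sigma_approx p0 g x \<longlonglongrightarrow> l"
      by (simp add: eq)
  next
    assume "Sigma_approx p0 g x \<longlonglongrightarrow> l"
    from tendsto_add[OF this r] show "Sigma_approx p g x \<longlonglongrightarrow> l"
      by (simp add: eq[abs_def])
  qed
  then show ?thesis
    unfolding Sigma_fun_def lim_def p0_def[symmetric] by simp
qed

fun bernoulli :: "nat \<Rightarrow> real" where
  "bernoulli 0 = 1"
| "bernoulli (Suc n) = - (\<Sum>j\<le>n. real ((n + 2) choose j) * bernoulli j) / real (n + 2)"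

lemma bernoulli_recurrence:
  "(\<Sum>j\<le>m. real ((m + 1) choose j) * bernoulli j) = 0 ^ m"
proof (cases m)
  case 0
  then show ?thesis by simp
next
  case (Suc n)
  have "(n + 2) choose (Suc n) = n + 2"
    using binomial_Suc_n[of "Suc n"] by simp
  then show ?thesis
    using Suc by (simp del: binomial_Suc_Suc)
qed

definition bernpoly :: "nat \<Rightarrow> real \<Rightarrow> real" where
  "bernpoly n x = (\<Sum>k\<le>n. real (n choose k) * bernoulli (n - k) * x ^ k)"

end

theory Submission
  imports Defs
begin

text \<open>
  Let \<open>f\<close> be \<open>Sigma_fun g\<close>. The asserted formulas are the Euler-Maclaurin formula of order \<open>r = 1\<close> or
  \<open>r = 2 q\<close> for \<open>f\<close> on the interval from \<open>x\<close> to \<open>x + 1\<close>, cut into \<open>m\<close> equal cells. Its boundary terms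
  contain \<open>f\<^sup>(\<^sup>k\<^sup>)(x + 1) - f\<^sup>(\<^sup>k\<^sup>)(x)\<close>, which is \<open>g\<^sup>(\<^sup>k\<^sup>)(x)\<close>, and the terms with odd index above \<open>1\<close>
  vanish with the Bernoulli numbers. The bounds on the remainder say that the Bernoulli polynomial is at
  most \<open>1/2\<close>, respectively at most the Bernoulli number, in absolute value on the unit interval
  (\<open>abs_bernpoly_even_le\<close>). The integral of \<open>\<bar>f\<^sup>(\<^sup>r\<^sup>)\<bar>\<close> reduces to \<open>\<bar>g\<^sup>(\<^sup>r\<^sup>-\<^sup>1\<^sup>)(x)\<bar>\<close> as soon as \<open>f\<^sup>(\<^sup>r\<^sup>)\<close> has
  constant sign from \<open>x\<close> on.

  The substance is therefore that \<open>f\<close> exists, solves the difference equation, is \<open>r\<close> times continuously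
  differentiable, and has an \<open>r\<close>-th derivative of eventually constant sign. One may assume \<open>r \<le> p\<close>. The
  increments of the sequence that defines \<open>f\<close> are, up to sign, the errors of Newton interpolation of
  \<open>x \<mapsto> g (x + n)\<close> at \<open>0, \<dots>, p\<close>. The \<open>k\<close>-th derivative of such an error vanishes at \<open>p - k + 1\<close> points,
  by Rolle's theorem, and is thus an interpolation error for \<open>g\<^sup>(\<^sup>k\<^sup>)\<close>, which is \<open>(p - k)\<close>-convex up to
  sign. Monotonicity of divided differences in their nodes bounds it by a multiple of
  \<open>\<Delta>\<^sup>p\<^sup>-\<^sup>k g\<^sup>(\<^sup>k\<^sup>)(n + M) - \<Delta>\<^sup>p\<^sup>-\<^sup>k g\<^sup>(\<^sup>k\<^sup>)(n - (p - k))\<close>, locally uniformly in \<open>x\<close>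
  (\<open>interpolation_error_bound\<close>). These bounds telescope, and \<open>s \<Delta>\<^sup>p\<^sup>-\<^sup>k g\<^sup>(\<^sup>k\<^sup>)\<close> is monotone and bounded, where
  the sign \<open>s\<close> distinguishes convexity from concavity; so all derivatives up to order \<open>r\<close> converge locally
  uniformly. Finally \<open>f\<close> inherits from \<open>g\<close> the opposite convexity of order \<open>p\<close>, its \<open>r\<close>-th derivative is
  convex or concave of order \<open>p - r\<close>, and a function of this kind eventually has constant sign
  (\<open>dd_sign_eventually_constant_sign\<close>).
\<close>

section \<open>Divided differences and convexity of higher order\<close>

text \<open>
  Divided differences are indexed by the set of their nodes. This builds in their symmetry, so that
  nodes can be exchanged without renumbering.
\<close>

definition dd :: "(real \<Rightarrow> real) \<Rightarrow> real set \<Rightarrow> real" where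
  "dd f S = (\<Sum>x\<in>S. f x / (\<Prod>y\<in>S - {x}. x - y))"

lemma dd_singleton [simp]: "dd f {a} = f a"
  by (simp add: dd_def)

lemma dd_cong: "(\<And>x. x \<in> S \<Longrightarrow> f x = g x) \<Longrightarrow> dd f S = dd g S"
  by (simp add: dd_def cong: sum.cong)

lemma dd_add: "dd (\<lambda>x. f x + g x) S = dd f S + dd g S"
  by (simp add: dd_def sum.distrib add_divide_distrib)

lemma dd_diff: "dd (\<lambda>x. f x - g x) S = dd f S - dd g S"
  by (simp add: dd_def sum_subtractf diff_divide_distrib)

lemma dd_cmult: "dd (\<lambda>x. c * f x) S = c * dd f S"
  by (simp add: dd_def sum_distrib_left)

lemma dd_sum: "dd (\<lambda>x. \<Sum>i\<in>I. f i x) S = (\<Sum>i\<in>I. dd (f i) S)"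
  unfolding dd_def by (simp add: sum_divide_distrib) (rule sum.swap)

lemma dd_shift: "dd f ((+) c ` S) = dd (\<lambda>x. f (c + x)) S"
proof -
  have "(+) c ` S - {c + x} = (+) c ` (S - {x})" for x :: real
    by auto
  then have "(\<Prod>y\<in>(+) c ` S - {c + x}. c + x - y) = (\<Prod>y\<in>S - {x}. x - y)" for x
    by (simp add: prod.reindex)
  then show ?thesis
    unfolding dd_def by (simp add: sum.reindex)
qed

text \<open>
  This is the recursion for divided differences, in the form that drops either of two arbitrary
  nodes. For a common node \<open>x\<close> the two coefficients have the denominators \<open>x - b\<close> and \<open>x - a\<close> apart
  from a common factor, and \<open>(x - a) - (x - b) = b - a\<close>.
\<close>

lemma dd_exchange:
  assumes "finite C" "a \<notin> C" "b \<notin> C" "a \<noteq> b"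
  shows "dd f (insert b C) - dd f (insert a C) = (b - a) * dd f (insert a (insert b C))"
proof -
  define P where "P x = (\<Prod>y\<in>C - {x}. x - y)" for x
  have prod1: "(\<Prod>y\<in>insert c C - {x}. x - y) = (x - c) * P x" if "x \<in> C" "c \<notin> C" for x c
  proof -
    have "insert c C - {x} = insert c (C - {x})" using that by auto
    then show ?thesis using that assms(1) by (simp add: P_def)
  qed
  have prod2: "(\<Prod>y\<in>insert a (insert b C) - {x}. x - y) = (x - a) * ((x - b) * P x)"
    if "x \<in> C" for x
  proof -
    have "insert a (insert b C) - {x} = insert a (insert b (C - {x}))"
      using that assms by auto
    then show ?thesis using that assms by (simp add: P_def)
  qed
  have prod4: "(\<Prod>y\<in>insert a (insert b C) - {a}. a - y) = (a - b) * P a"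
              "(\<Prod>y\<in>insert a (insert b C) - {b}. b - y) = (b - a) * P b"
  proof -
    have "insert a (insert b C) - {a} = insert b C" "insert a (insert b C) - {b} = insert a C"
      using assms by auto
    then show "(\<Prod>y\<in>insert a (insert b C) - {a}. a - y) = (a - b) * P a"
              "(\<Prod>y\<in>insert a (insert b C) - {b}. b - y) = (b - a) * P b"
      using assms by (simp_all) (simp_all add: P_def)
  qed
  have single: "dd f (insert c C) = f c / P c + (\<Sum>x\<in>C. f x / ((x - c) * P x))"
    if "c \<notin> C" for c
    unfolding dd_def using that assms(1) by (simp add: prod1) (simp add: P_def)
  have "dd f (insert a (insert b C)) =
      f a / (\<Prod>y\<in>insert a (insert b C) - {a}. a - y) +
      (f b / (\<Prod>y\<in>insert a (insert b C) - {b}. b - y) +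
       (\<Sum>x\<in>C. f x / (\<Prod>y\<in>insert a (insert b C) - {x}. x - y)))"
    unfolding dd_def using assms by simp
  then have "dd f (insert a (insert b C)) = f a / ((a - b) * P a) +
      (f b / ((b - a) * P b) + (\<Sum>x\<in>C. f x / ((x - a) * ((x - b) * P x))))"
    by (simp only: prod4) (simp add: prod2 cong: sum.cong)
  moreover have "(b - a) * (f a / ((a - b) * P a)) = - (f a / P a)"
  proof -
    have "(b - a) / (a - b) = - 1" using assms(4) by (simp add: field_simps)
    then show ?thesis by (metis mult_minus1 times_divide_eq_left times_divide_times_eq mult.commute
          times_divide_eq_right)
  qed
  moreover have "(b - a) * (f b / ((b - a) * P b)) = f b / P b"
    using assms(4) by simp
  moreover have "f x / ((x - b) * P x) - f x / ((x - a) * P x)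
      = (b - a) * (f x / ((x - a) * ((x - b) * P x)))" if "x \<in> C" for x
  proof -
    have "x - a \<noteq> 0" "x - b \<noteq> 0" "P x \<noteq> 0"
      using that assms by (auto simp: P_def)
    then show ?thesis by (simp add: divide_simps) (simp add: algebra_simps)
  qed
  ultimately show ?thesis
    by (simp add: single assms(2,3) distrib_left sum_distrib_left sum_subtractf[symmetric])
qed

text \<open>
  A linear factor that vanishes at a node removes this node. This is how the induction over
  polynomials below loses one degree together with one node.
\<close>

lemma dd_mult_linear:
  assumes "finite S" "a \<in> S"
  shows "dd (\<lambda>x. (x - a) * f x) S = dd f (S - {a})"
proof -
  have "dd (\<lambda>x. (x - a) * f x) S = (\<Sum>x\<in>S - {a}. (x - a) * f x / (\<Prod>y\<in>S - {x}. x - y))"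
    unfolding dd_def using assms by (simp add: sum.remove)
  also have "\<dots> = dd f (S - {a})"
    unfolding dd_def
  proof (rule sum.cong)
    fix x assume x: "x \<in> S - {a}"
    have "(\<Prod>y\<in>S - {x}. x - y) = (x - a) * (\<Prod>y\<in>S - {x} - {a}. x - y)"
      using x assms by (intro prod.remove) auto
    moreover have "S - {x} - {a} = S - {a} - {x}" by auto
    ultimately show "(x - a) * f x / (\<Prod>y\<in>S - {x}. x - y) = f x / (\<Prod>y\<in>S - {a} - {x}. x - y)"
      using x by simp
  qed simp
  finally show ?thesis .
qed

lemma dd_const:
  assumes "card S = n + 2"
  shows "dd (\<lambda>x. c) S = 0"
  using assms
proof (induction n arbitrary: S)
  case 0
  then have "card S = 2" by simp
  then obtain a b where "S = {a, b}" "a \<noteq> b"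
    unfolding card_2_iff by blast
  then show ?case
    using dd_exchange[of "{}" a b "\<lambda>x. c"] by simp
next
  case (Suc n)
  then obtain a A where A: "S = insert a A" "a \<notin> A" "card A = n + 2" "finite A"
    by (metis Suc_eq_plus1 add_Suc card_Suc_eq_finite)
  then obtain b C where C: "A = insert b C" "b \<notin> C" "finite C" "card C = n + 1"
    by (metis Suc_eq_plus1 add_2_eq_Suc' card_Suc_eq_finite)
  have "(b - a) * dd (\<lambda>x. c) S = 0"
    using dd_exchange[of C a b "\<lambda>x. c"] Suc.IH[of "insert b C"] Suc.IH[of "insert a C"] A C
    by simp
  then show ?case using A C by auto
qed

text \<open>
  A polynomial \<open>c + x Q(x)\<close> is rewritten as \<open>c + (x - a) Q(x) + a Q(x)\<close> with a node \<open>a\<close>, which reduces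
  the claim to \<open>Q\<close> with and without the node \<open>a\<close>.
\<close>

lemma dd_poly:
  assumes "degree P + 2 \<le> card S"
  shows "dd (poly P) S = 0"
  using assms
proof (induction P arbitrary: S)
  case 0
  then show ?case by (simp add: dd_def)
next
  case (pCons c Q)
  have const: "dd (\<lambda>x. c) S = 0"
    using dd_const[of S "card S - 2" c] pCons.prems by simp
  show ?case
  proof (cases "Q = 0")
    case True
    then show ?thesis using const by (simp add: dd_def)
  next
    case False
    then have deg: "degree Q + 3 \<le> card S" using pCons.prems by simp
    then have "finite S" "S \<noteq> {}" by (auto intro: card_ge_0_finite)
    then obtain a where a: "a \<in> S" by blast
    have "dd (poly (pCons c Q)) S = dd (\<lambda>x. c + ((x - a) * poly Q x + a * poly Q x)) S"
      by (rule dd_cong) (simp add: algebra_simps)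
    also have "\<dots> = dd (\<lambda>x. c) S + (dd (poly Q) (S - {a}) + a * dd (poly Q) S)"
      by (simp only: dd_add dd_cmult dd_mult_linear[OF \<open>finite S\<close> a])
    also have "\<dots> = 0"
      using deg a \<open>finite S\<close> by (simp add: const pCons.IH)
    finally show ?thesis .
  qed
qed

lemma fwd_diff_funpow_eq_dd:
  "(fwd_diff ^^ n) f x = fact n * dd f ((\<lambda>i. x + real i) ` {..n})"
proof (induction n arbitrary: x)
  case 0
  then show ?case by simp
next
  case (Suc n)
  define C where "C = (\<lambda>i. x + real i) ` {1..n}"
  have C: "finite C" "x \<notin> C" "x + real (Suc n) \<notin> C"
    by (auto simp: C_def)
  have "(\<lambda>i. x + 1 + real i) ` {..n} = (\<lambda>i. x + real i) ` (Suc ` {..n})"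
    by (simp add: image_image algebra_simps)
  also have "Suc ` {..n} = insert (Suc n) {1..n}"
    by (auto simp: image_Suc_atMost)
  finally have 1: "(\<lambda>i. x + 1 + real i) ` {..n} = insert (x + real (Suc n)) C"
    by (simp add: C_def)
  have "{..n} = insert 0 {1..n}" by auto
  then have 2: "(\<lambda>i. x + real i) ` {..n} = insert x C"
    by (simp add: C_def)
  have "{..Suc n} = insert 0 (insert (Suc n) {1..n})" by auto
  then have 3: "(\<lambda>i. x + real i) ` {..Suc n} = insert x (insert (x + real (Suc n)) C)"
    by (simp add: C_def)
  have "(fwd_diff ^^ Suc n) f x
      = fact n * (dd f (insert (x + real (Suc n)) C) - dd f (insert x C))"
    by (simp add: fwd_diff_def[of "(fwd_diff ^^ n) f"] Suc.IH 1 2 right_diff_distrib)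
  also have "\<dots> = fact (Suc n) * dd f (insert x (insert (x + real (Suc n)) C))"
    using dd_exchange[of C x "x + real (Suc n)" f] C by simp
  finally show ?case by (simp add: 3)
qed

text \<open>
  The sign \<open>s\<close>, always \<open>1\<close> or \<open>-1\<close> in use, treats convexity and concavity at once. The number \<open>n\<close>
  counts nodes, so that \<open>n = p + 2\<close> is \<open>p\<close>-convexity of \<open>s f\<close> and \<open>n = 1\<close> says that \<open>s f\<close> is
  nonnegative.
\<close>

definition dd_sign :: "real \<Rightarrow> nat \<Rightarrow> real set \<Rightarrow> (real \<Rightarrow> real) \<Rightarrow> bool" where
  "dd_sign s n I f \<longleftrightarrow> (\<forall>S. finite S \<and> card S = n \<and> S \<subseteq> I \<longrightarrow> 0 \<le> s * dd f S)"

lemma dd_signD: "dd_sign s n I f \<Longrightarrow> finite S \<Longrightarrow> card S = n \<Longrightarrow> S \<subseteq> I \<Longrightarrow> 0 \<le> s * dd f S"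
  by (simp add: dd_sign_def)

lemma finite_real_enumeration:
  fixes S :: "real set"
  assumes "finite S" "card S = n"
  obtains X where "strict_mono_on {..<n} X" "X ` {..<n} = S"
proof
  let ?X = "\<lambda>i. sorted_list_of_set S ! i"
  have len: "length (sorted_list_of_set S) = n" using assms by simp
  show "strict_mono_on {..<n} ?X"
    using sorted_wrt_nth_less[OF strict_sorted_list_of_set] len
    by (auto simp: strict_mono_on_def)
  have "?X ` {..<n} = set (sorted_list_of_set S)"
    by (metis len nth_image order_refl take_all_iff lessThan_atLeast0)
  then show "?X ` {..<n} = S" using assms by simp
qed

lemma divided_difference_eq_dd:
  assumes "strict_mono_on {..n} X"
  shows "divided_difference f n X = dd f (X ` {..n})"
proof -
  have inj: "inj_on X {..n}" using assms by (rule strict_mono_on_imp_inj_on)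
  have "(\<Prod>y\<in>X ` {..n} - {X k}. X k - y) = (\<Prod>j\<in>{..n} - {k}. X k - X j)" if "k \<le> n" for k
  proof -
    have "X ` {..n} - {X k} = X ` ({..n} - {k})"
      using inj that by (auto simp: inj_on_def)
    moreover have "inj_on X ({..n} - {k})"
      using inj by (rule inj_on_subset) auto
    ultimately show ?thesis by (simp add: prod.reindex)
  qed
  then show ?thesis
    unfolding divided_difference_def dd_def using inj by (simp add: sum.reindex)
qed

lemma K_class_imp_dd_sign:
  assumes "f \<in> K_class p"
  obtains s a where "\<bar>s\<bar> = 1" "a > 0" "dd_sign s (p + 2) {a..} f"
proof -
  from assms obtain a where a: "a > 0"
    and cases: "convex_of_order p {a..} f \<or> concave_of_order p {a..} f"
    by (auto simp: K_class_def)
  have enum: "\<exists>X. strict_mono_on {..p + 1} X \<and> X ` {..p + 1} = S"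
    if S: "finite S" "card S = p + 2" for S :: "real set"
  proof -
    have "{..<p + 2} = {..p + 1}" by auto
    then show ?thesis using finite_real_enumeration[OF S] by metis
  qed
  from cases show thesis
  proof
    assume c: "convex_of_order p {a..} f"
    have "dd_sign 1 (p + 2) {a..} f"
      unfolding dd_sign_def
    proof (intro allI impI)
      fix S assume S: "finite S \<and> card S = p + 2 \<and> S \<subseteq> {a..}"
      then obtain X where X: "strict_mono_on {..p + 1} X" "X ` {..p + 1} = S"
        using enum by blast
      then have "divided_difference f (p + 1) X \<ge> 0"
        using c S unfolding convex_of_order_def by blast
      then show "0 \<le> 1 * dd f S" using divided_difference_eq_dd[OF X(1)] X(2) by simp
    qed
    then show thesis using a that[of 1] by simp
  next
    assume c: "concave_of_order p {a..} f"
    have "dd_sign (-1) (p + 2) {a..} f"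
      unfolding dd_sign_def
    proof (intro allI impI)
      fix S assume S: "finite S \<and> card S = p + 2 \<and> S \<subseteq> {a..}"
      then obtain X where X: "strict_mono_on {..p + 1} X" "X ` {..p + 1} = S"
        using enum by blast
      then have "divided_difference f (p + 1) X \<le> 0"
        using c S unfolding concave_of_order_def by blast
      then show "0 \<le> (-1) * dd f S" using divided_difference_eq_dd[OF X(1)] X(2) by simp
    qed
    then show thesis using a that[of "-1"] by simp
  qed
qed

text \<open>
  Replacing a node \<open>x\<close> by a larger \<open>y\<close> changes the divided difference by \<open>y - x\<close> times a divided
  difference with one node more, whose sign is given. Moving the largest node first keeps the
  intermediate nodes distinct.
\<close>

lemma dd_sign_mono_nodes:
  assumes f: "dd_sign s (Suc n) {a..} f"
    and X: "strict_mono_on {..<n} X" "\<And>i. i < n \<Longrightarrow> a \<le> X i"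
    and Y: "strict_mono_on {..<n} Y" and le: "\<And>i. i < n \<Longrightarrow> X i \<le> Y i"
  shows "s * dd f (X ` {..<n}) \<le> s * dd f (Y ` {..<n})"
proof -
  \<comment> \<open>\<open>N j\<close> has its nodes from position \<open>j\<close> on already moved to their final places.\<close>
  define N where "N j = X ` {..<j} \<union> Y ` {j..<n}" for j
  have step: "s * dd f (N (Suc j)) \<le> s * dd f (N j)" if j: "j < n" for j
  proof -
    define C where "C = X ` {..<j} \<union> Y ` {Suc j..<n}"
    have fin: "finite C" by (simp add: C_def)
    have Xj: "N (Suc j) = insert (X j) C"
      by (auto simp: N_def C_def lessThan_Suc)
    have "{j..<n} = insert j {Suc j..<n}" using j by auto
    then have Yj: "N j = insert (Y j) C"
      by (auto simp: N_def C_def)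
    show ?thesis
    proof (cases "X j = Y j")
      case True
      then show ?thesis using Xj Yj by simp
    next
      case False
      then have lt: "X j < Y j" using le[OF j] by simp
      have below: "X i < X j" if "i < j" for i
        using X(1) that j by (auto simp: strict_mono_on_def)
      have above: "Y j < Y i" if "j < i" "i < n" for i
        using Y that by (auto simp: strict_mono_on_def)
      have notin: "X j \<notin> C" "Y j \<notin> C"
      proof -
        have "c < X j \<or> Y j < c" if "c \<in> C" for c
          using that below above by (auto simp: C_def Suc_le_eq)
        then show "X j \<notin> C" "Y j \<notin> C" using lt by force+
      qed
      have card: "card C = n - 1"
      proof -
        have "inj_on X {..<j}" "inj_on Y {Suc j..<n}"
          using j by (auto intro!: inj_on_subset[OF strict_mono_on_imp_inj_on[OF X(1)]]
                              inj_on_subset[OF strict_mono_on_imp_inj_on[OF Y]])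
        moreover have "X ` {..<j} \<inter> Y ` {Suc j..<n} = {}"
        proof -
          have "X i < Y k" if "i < j" "Suc j \<le> k" "k < n" for i k
            using below[of i] lt above[of k] that by simp
          then show ?thesis by fastforce
        qed
        ultimately have "card C = j + (n - Suc j)"
          unfolding C_def by (subst card_Un_disjoint) (simp_all add: card_image)
        then show ?thesis using j by simp
      qed
      have "C \<subseteq> {a..}"
        using X(2) order_trans[OF X(2) le] j by (auto simp: C_def)
      moreover have "a \<le> X j" "a \<le> Y j" using X(2)[OF j] lt by auto
      ultimately have "0 \<le> s * dd f (insert (X j) (insert (Y j) C))"
        using fin notin card lt j by (intro dd_signD[OF f]) auto
      then have "0 \<le> (Y j - X j) * (s * dd f (insert (X j) (insert (Y j) C)))"
        using lt by simp
      also have "\<dots> = s * (dd f (N j) - dd f (N (Suc j)))"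
        using dd_exchange[OF fin notin, of f] lt by (simp add: Xj Yj)
      finally show ?thesis by (simp add: right_diff_distrib)
    qed
  qed
  have "s * dd f (N n) \<le> s * dd f (N 0)"
proof -
    have "s * dd f (N j) \<le> s * dd f (N 0)" if "j \<le> n" for j
      using that by (induction j) (auto intro: order_trans[OF step])
    then show ?thesis by simp
  qed
  then show ?thesis by (simp add: N_def lessThan_atLeast0)
qed

lemma dd_sign_mono_separated:
  assumes f: "dd_sign s (Suc n) {a..} f"
    and S: "finite S" "card S = n" "S \<subseteq> {a..b}" and T: "finite T" "card T = n" "T \<subseteq> {b..}"
  shows "s * dd f S \<le> s * dd f T"
proof -
  obtain X where X: "strict_mono_on {..<n} X" "X ` {..<n} = S"
    using finite_real_enumeration[OF S(1,2)] .
  obtain Y where Y: "strict_mono_on {..<n} Y" "Y ` {..<n} = T"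
    using finite_real_enumeration[OF T(1,2)] .
  have "X i \<in> S" "Y i \<in> T" if "i < n" for i
    using X(2) Y(2) that by auto
  then have "a \<le> X i" "X i \<le> b" "b \<le> Y i" if "i < n" for i
    using S(3) T(3) that by (meson atLeastAtMost_iff atLeast_iff subsetD)+
  then show ?thesis
    using dd_sign_mono_nodes[OF f X(1) _ Y(1)] X(2) Y(2) by (meson order_trans)
qed

lemma dd_sign_fwd_diff_mono:
  assumes "dd_sign s (n + 2) {a..} f" "a \<le> x" "x \<le> y"
  shows "s * (fwd_diff ^^ n) f x \<le> s * (fwd_diff ^^ n) f y"
proof -
  have "s * dd f ((\<lambda>i. x + real i) ` {..<Suc n}) \<le> s * dd f ((\<lambda>i. y + real i) ` {..<Suc n})"
    using assms by (intro dd_sign_mono_nodes[of s "Suc n" a f]) (auto simp: strict_mono_on_def)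
  then have "fact n * (s * dd f ((\<lambda>i. x + real i) ` {..<Suc n}))
      \<le> fact n * (s * dd f ((\<lambda>i. y + real i) ` {..<Suc n}))"
    by (rule mult_left_mono) simp
  then show ?thesis
    by (simp only: fwd_diff_funpow_eq_dd lessThan_Suc_atMost mult.left_commute[of s])
qed

lemma dd_between_fwd_diffs:
  assumes f: "dd_sign s (n + 2) {a..} f" and T: "finite T" "card T = n + 1" "T \<subseteq> {u..v}"
    and a: "a \<le> u - real n"
  shows "s * (fwd_diff ^^ n) f (u - real n) / fact n \<le> s * dd f T"
    and "s * dd f T \<le> s * (fwd_diff ^^ n) f v / fact n"
proof -
  let ?N = "\<lambda>y. (\<lambda>i. y + real i) ` {..n}"
  have card: "card (?N y) = Suc n" for y
    by (subst card_image) (auto simp: inj_on_def)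
  have f': "dd_sign s (Suc (Suc n)) {a..} f" using f by simp
  have "s * dd f (?N (u - real n)) \<le> s * dd f T"
    using T a by (intro dd_sign_mono_separated[OF f', of _ u]) (auto simp: card)
  then show "s * (fwd_diff ^^ n) f (u - real n) / fact n \<le> s * dd f T"
    by (simp add: fwd_diff_funpow_eq_dd)
  have "s * dd f T \<le> s * dd f (?N v)"
  proof (rule dd_sign_mono_separated[OF f', of _ v])
    show "T \<subseteq> {a..v}" using T(3) a by fastforce
  qed (use T card in auto)
  then show "s * dd f T \<le> s * (fwd_diff ^^ n) f v / fact n"
    by (simp add: fwd_diff_funpow_eq_dd)
qed

text \<open>
  The error of interpolation at \<open>y\<close> is a product of \<open>d + 1\<close> distances times a divided difference with
  \<open>d + 2\<close> nodes. One of the distances turns the latter into the difference of two divided differences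
  with \<open>d + 1\<close> nodes. Both are squeezed, by monotonicity in the nodes, between the values at equidistant
  nodes to the left of \<open>u\<close> and to the right of \<open>v\<close>. The resulting bound is a difference of two values of
  one function of the position, so it telescopes when the interval is translated.
\<close>

lemma interpolation_error_bound:
  assumes h: "dd_sign s (d + 2) {a..} h" and s: "\<bar>s\<bar> = 1" and R: "degree R \<le> d"
    and T: "finite T" "card T = d + 1" "T \<subseteq> {u..v}" "\<And>t. t \<in> T \<Longrightarrow> h t = poly R t"
    and y: "u \<le> y" "y \<le> v" and a: "a \<le> u - real d"
  shows "\<bar>h y - poly R y\<bar> \<le> (v - u) ^ d *
    ((s * (fwd_diff ^^ d) h v - s * (fwd_diff ^^ d) h (u - real d)) / fact d)"
proof (cases "y \<in> T")
  case True
  note b = dd_between_fwd_diffs[OF h T(1-3) a]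
  have "0 \<le> (s * (fwd_diff ^^ d) h v - s * (fwd_diff ^^ d) h (u - real d)) / fact d"
    using order_trans[OF b] by (simp add: diff_divide_distrib)
  then have "0 \<le> (v - u) ^ d *
      ((s * (fwd_diff ^^ d) h v - s * (fwd_diff ^^ d) h (u - real d)) / fact d)"
    using y by (intro mult_nonneg_nonneg zero_le_power) auto
  then show ?thesis using True T(4) by simp
next
  case False
  obtain t where t: "t \<in> T" using T(2) by fastforce
  define C where "C = T - {t}"
  have C: "finite C" "t \<notin> C" "y \<notin> C" "T = insert t C" "card C = d" "C \<subseteq> {u..v}"
    using T t False by (auto simp: C_def)
  define e where "e x = h x - poly R x" for x
  have dd_e: "dd e S = dd h S" if "card S = d + 2" for S
    using dd_poly[of R S] R that by (simp add: e_def[abs_def] dd_diff)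
  have zero: "dd e T = 0"
    using T(4) by (simp add: dd_def e_def)
  have "y \<noteq> t" using False t by auto
  have prod_ne: "(\<Prod>x\<in>C. y - x) \<noteq> 0" using C by auto
  have "dd e (insert y C) = e y / (\<Prod>x\<in>C. y - x)"
    unfolding dd_def using C T(4) by (simp add: e_def)
  then have "e y = (\<Prod>x\<in>C. y - x) * dd e (insert y C)"
    using prod_ne by simp
  also have "dd e (insert y C) = dd e (insert y C) - dd e (insert t C)"
    using zero C(4) by simp
  also have "\<dots> = (y - t) * dd e (insert t (insert y C))"
    using C \<open>y \<noteq> t\<close> by (intro dd_exchange) auto
  also have "\<dots> = (y - t) * dd h (insert t (insert y C))"
    using C \<open>y \<noteq> t\<close> by (subst dd_e) auto
  also have "\<dots> = dd h (insert y C) - dd h T"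
    using C \<open>y \<noteq> t\<close> by (subst C(4), intro dd_exchange[symmetric]) auto
  finally have e: "e y = (\<Prod>x\<in>C. y - x) * (dd h (insert y C) - dd h T)" .
  have "\<bar>\<Prod>x\<in>C. y - x\<bar> = (\<Prod>x\<in>C. \<bar>y - x\<bar>)" by (rule abs_prod)
  also have "\<dots> \<le> (\<Prod>x\<in>C. v - u)"
    using C(6) y by (intro prod_mono) fastforce
  finally have prod_le: "\<bar>\<Prod>x\<in>C. y - x\<bar> \<le> (v - u) ^ d" using C(5) by simp
  have yC: "finite (insert y C)" "card (insert y C) = d + 1" "insert y C \<subseteq> {u..v}"
    using C y by auto
  note b1 = dd_between_fwd_diffs[OF h T(1-3) a] and b2 = dd_between_fwd_diffs[OF h yC a]
  have "\<bar>dd h (insert y C) - dd h T\<bar> = \<bar>s * dd h (insert y C) - s * dd h T\<bar>"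
    using s by (simp add: right_diff_distrib[symmetric] abs_mult)
  also have "\<dots> \<le> (s * (fwd_diff ^^ d) h v - s * (fwd_diff ^^ d) h (u - real d)) / fact d"
    using b1 b2 by (simp add: diff_divide_distrib abs_le_iff)
  finally have "\<bar>e y\<bar> \<le> (v - u) ^ d *
    ((s * (fwd_diff ^^ d) h v - s * (fwd_diff ^^ d) h (u - real d)) / fact d)"
    unfolding e abs_mult using y by (intro mult_mono prod_le) auto
  then show ?thesis by (simp add: e_def)
qed

text \<open>
  A translation of all nodes to the right increases \<open>s\<close> times the divided difference, by monotonicity
  in the nodes. The divided difference of \<open>f'\<close> is the derivative with respect to this translation.
\<close>

lemma dd_sign_deriv:
  assumes f: "dd_sign s (Suc n) {a..} f"
    and f': "\<And>x. a \<le> x \<Longrightarrow> (f has_real_derivative f' x) (at x)"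
  shows "dd_sign s n {a..} f'"
  unfolding dd_sign_def
proof (intro allI impI, elim conjE)
  fix S :: "real set" assume S: "finite S" "card S = n" "S \<subseteq> {a..}"
  obtain X where X: "strict_mono_on {..<n} X" "X ` {..<n} = S"
    using finite_real_enumeration[OF S(1,2)] .
  define \<phi> where "\<phi> t = s * dd f ((+) t ` S)" for t
  have mono: "\<phi> 0 \<le> \<phi> t" if "0 \<le> t" for t
  proof -
    have aX: "a \<le> X i" if "i < n" for i
      using that X(2) S(3) by auto
    have "s * dd f (X ` {..<n}) \<le> s * dd f ((\<lambda>i. t + X i) ` {..<n})"
      using X(1) that aX by (intro dd_sign_mono_nodes[OF f]) (auto simp: strict_mono_on_def)
    also have "(\<lambda>i. t + X i) ` {..<n} = (+) t ` S"
      using X(2) by (auto simp: image_image)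
    finally show ?thesis using X(2) by (simp add: \<phi>_def)
  qed
  have "(\<phi> has_real_derivative s * dd f' S) (at 0)"
    unfolding \<phi>_def dd_shift unfolding dd_def
  proof (rule DERIV_cmult[OF DERIV_sum[OF DERIV_cdivide]])
    fix x assume "x \<in> S"
    then have "((\<lambda>t. f (t + x)) has_real_derivative f' x) (at 0)"
      using DERIV_shift[of f "f' x" 0 x] f' S(3) by auto
    then show "((\<lambda>t. f (t + x)) has_real_derivative f' x) (at 0)" .
  qed
  then show "0 \<le> s * dd f' S"
    using DERIV_neg_dec_right[of \<phi> "s * dd f' S" 0] mono
    by (metis add_0 dense less_le_not_le not_le)
qed

lemma dd_sign_higher_deriv:
  assumes f: "dd_sign s (p + 2) {a..} f" and "k \<le> p"
    and D: "\<And>j x. j < k \<Longrightarrow> a \<le> x \<Longrightarrow>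
      ((deriv ^^ j) f has_real_derivative (deriv ^^ Suc j) f x) (at x)"
  shows "dd_sign s (p - k + 2) {a..} ((deriv ^^ k) f)"
  using assms(2) D
proof (induction k)
  case 0
  then show ?case using f by simp
next
  case (Suc k)
  have "dd_sign s (Suc (p - Suc k + 2)) {a..} ((deriv ^^ k) f)"
    using Suc.IH Suc.prems by (simp add: Suc_diff_Suc)
  then show ?case by (rule dd_sign_deriv) (rule Suc.prems(2)[OF lessI])
qed

text \<open>
  Since \<open>s\<close> times the divided difference with \<open>n\<close> nodes increases in the nodes, it is either never
  positive, or positive for all nodes beyond some set where it is.
\<close>

lemma dd_sign_lower_order:
  assumes f: "dd_sign s (Suc n) {a..} f" and s: "\<bar>s\<bar> = 1"
  shows "\<exists>s' b. \<bar>s'\<bar> = 1 \<and> a \<le> b \<and> dd_sign s' n {b..} f"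
proof (cases "\<forall>S. finite S \<and> card S = n \<and> S \<subseteq> {a..} \<longrightarrow> s * dd f S \<le> 0")
  case True
  then have "dd_sign (- s) n {a..} f" by (simp add: dd_sign_def)
  then show ?thesis using s by (intro exI[of _ "- s"] exI[of _ a]) simp
next
  case False
  then obtain S where S: "finite S" "card S = n" "S \<subseteq> {a..}" "0 < s * dd f S"
    by (auto simp: not_le)
  then have "S \<noteq> {}" by (auto simp: dd_def)
  have b: "S \<subseteq> {a..Max S}" "a \<le> Max S"
    using S \<open>S \<noteq> {}\<close> subsetD[OF S(3) Max_in] by auto
  have "dd_sign s n {Max S..} f"
    unfolding dd_sign_def
  proof (intro allI impI, elim conjE)
    fix T :: "real set" assume "finite T" "card T = n" "T \<subseteq> {Max S..}"
    then have "s * dd f S \<le> s * dd f T"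
      by (rule dd_sign_mono_separated[OF f S(1,2) b(1)])
    then show "0 \<le> s * dd f T" using S(4) by linarith
  qed
  then show ?thesis using s b by blast
qed

lemma dd_sign_eventually_constant_sign:
  assumes "dd_sign s (Suc n) {a..} f" "\<bar>s\<bar> = 1"
  shows "\<exists>s' b. \<bar>s'\<bar> = 1 \<and> a \<le> b \<and> (\<forall>x\<ge>b. 0 \<le> s' * f x)"
  using assms
proof (induction n arbitrary: s a)
  case 0
  have "0 \<le> s * f x" if "a \<le> x" for x
    using dd_signD[OF 0(1), of "{x}"] that by simp
  then show ?case using 0(2) by blast
next
  case (Suc n)
  obtain s' b where "\<bar>s'\<bar> = 1" "a \<le> b" "dd_sign s' (Suc n) {b..} f"
    using dd_sign_lower_order[OF Suc.prems] by blast
  then show ?case using Suc.IH by (meson order_trans)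
qed

lemma rolle_finite:
  fixes e e' :: "real \<Rightarrow> real"
  assumes S: "finite S" "card S = Suc n" "S \<subseteq> {u..v}" "\<And>x. x \<in> S \<Longrightarrow> e x = 0"
    and e': "\<And>x. u \<le> x \<Longrightarrow> x \<le> v \<Longrightarrow> (e has_real_derivative e' x) (at x)"
  shows "\<exists>T. finite T \<and> card T = n \<and> T \<subseteq> {u..v} \<and> (\<forall>x\<in>T. e' x = 0)"
proof -
  obtain X where X: "strict_mono_on {..<Suc n} X" "X ` {..<Suc n} = S"
    using finite_real_enumeration[OF S(1,2)] .
  have XS: "X i \<in> S" if "i \<le> n" for i using X(2) that by auto
  have "\<exists>z. X i < z \<and> z < X (Suc i) \<and> e' z = 0" if i: "i < n" for i
  proof -
    have lt: "X i < X (Suc i)" using X(1) i by (auto simp: strict_mono_on_def)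
    have uv: "u \<le> X i" "X (Suc i) \<le> v" using XS[of i] XS[of "Suc i"] S(3) i by auto
    have "\<exists>z. X i < z \<and> z < X (Suc i) \<and> e (X (Suc i)) - e (X i) = (X (Suc i) - X i) * e' z"
      using lt uv by (intro MVT2) (auto intro!: e')
    then show ?thesis using S(4)[OF XS] i lt by auto
  qed
  then obtain \<xi> where \<xi>: "\<And>i. i < n \<Longrightarrow> X i < \<xi> i \<and> \<xi> i < X (Suc i) \<and> e' (\<xi> i) = 0"
    by metis
  have mono: "\<xi> i < \<xi> j" if "i < j" "j < n" for i j
  proof -
    have "X (Suc i) \<le> X j"
      using strict_mono_on_leD[OF X(1), of "Suc i" j] that by simp
    then show ?thesis using \<xi>[of i] \<xi>[of j] that by linarith
  qed
  have "inj_on \<xi> {..<n}"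
    using mono by (intro linorder_inj_onI) (auto simp: less_imp_neq)
  then have "card (\<xi> ` {..<n}) = n" by (simp add: card_image)
  moreover have "u \<le> \<xi> i" "\<xi> i \<le> v" if "i < n" for i
    using \<xi>[OF that] XS[of i] XS[of "Suc i"] S(3) that by fastforce+
  ultimately show ?thesis
    using \<xi> by (intro exI[of _ "\<xi> ` {..<n}"]) auto
qed

lemma fwd_diff_shift: "(fwd_diff ^^ n) (\<lambda>x. f (x + c)) x = (fwd_diff ^^ n) f (x + c)"
  by (induction n arbitrary: x) (simp_all add: fwd_diff_def add.commute add.left_commute)

lemma fwd_diff_deriv:
  assumes "\<And>x. a \<le> x \<Longrightarrow> (f has_real_derivative f' x) (at x)" "a \<le> x"
  shows "((fwd_diff ^^ n) f has_real_derivative (fwd_diff ^^ n) f' x) (at x)"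
  using assms(2)
proof (induction n arbitrary: x)
  case (Suc n)
  have "((\<lambda>x. (fwd_diff ^^ n) f (x + 1)) has_real_derivative (fwd_diff ^^ n) f' (x + 1)) (at x)"
    using Suc.IH[of "x + 1"] Suc.prems by (simp add: DERIV_shift)
  from DERIV_diff[OF this Suc.IH[OF Suc.prems]] show ?case
    by (simp add: fwd_diff_def[of "(fwd_diff ^^ n) f"] fwd_diff_def[of "(fwd_diff ^^ n) f'"])
qed (use assms in simp)

text \<open>
  This is the expansion of the \<open>i\<close>-th power of the shift operator \<open>1 + \<Delta>\<close>; terms with \<open>j > i\<close> vanish.
\<close>

lemma newton_forward_difference:
  assumes "i \<le> p"
  shows "(\<Sum>j\<le>p. (real i gchoose j) * (fwd_diff ^^ j) f x) = f (x + real i)"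
  using assms
proof (induction i arbitrary: x)
  case 0
  have "(\<Sum>j\<le>p. (real 0 gchoose j) * (fwd_diff ^^ j) f x)
      = (\<Sum>j\<le>p. if j = 0 then f x else 0)"
    by (rule sum.cong) (auto simp: gbinomial_0_left)
  then show ?case by simp
next
  case (Suc i)
  obtain p' where p': "p = Suc p'" using Suc.prems by (cases p) auto
  have top: "(real i gchoose p) = 0"
    using Suc.prems by (simp add: gbinomial_of_nat_symmetric binomial_gbinomial[symmetric])
  have "f (x + real (Suc i)) = (\<Sum>j\<le>p. (real i gchoose j) * (fwd_diff ^^ j) f (x + 1))"
    using Suc.IH[of "x + 1"] Suc.prems by (simp add: add.assoc add.commute[of 1])
  also have "\<dots> = (\<Sum>j\<le>p. (real i gchoose j) * (fwd_diff ^^ j) f x)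
      + (\<Sum>j\<le>p. (real i gchoose j) * (fwd_diff ^^ Suc j) f x)"
    by (simp add: fwd_diff_def[of "(fwd_diff ^^ _) f"] sum.distrib[symmetric] algebra_simps)
  also have "(\<Sum>j\<le>p. (real i gchoose j) * (fwd_diff ^^ Suc j) f x)
      = (\<Sum>j\<le>p'. (real i gchoose j) * (fwd_diff ^^ Suc j) f x)"
    using top by (simp add: p')
  also have "(\<Sum>j\<le>p. (real i gchoose j) * (fwd_diff ^^ j) f x)
      = f x + (\<Sum>j\<le>p'. (real i gchoose Suc j) * (fwd_diff ^^ Suc j) f x)"
    unfolding p' by (subst sum.atMost_Suc_shift) simp
  also have "f x + (\<Sum>j\<le>p'. (real i gchoose Suc j) * (fwd_diff ^^ Suc j) f x)
      + (\<Sum>j\<le>p'. (real i gchoose j) * (fwd_diff ^^ Suc j) f x)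
      = f x + (\<Sum>j\<le>p'. (real (Suc i) gchoose Suc j) * (fwd_diff ^^ Suc j) f x)"
    using gbinomial_Suc_Suc[of "real i"]
    by (simp add: sum.distrib[symmetric] algebra_simps del: funpow.simps)
  also have "\<dots> = (\<Sum>j\<le>p. (real (Suc i) gchoose j) * (fwd_diff ^^ j) f x)"
    unfolding p' by (subst sum.atMost_Suc_shift) simp
  finally show ?case by simp
qed

definition gbinom_poly :: "nat \<Rightarrow> real poly" where
  "gbinom_poly j = smult (1 / fact j) (\<Prod>i<j. [:- real i, 1:])"

lemma poly_gbinom_poly [simp]: "poly (gbinom_poly j) x = x gchoose j"
  by (simp add: gbinom_poly_def poly_prod gbinomial_prod_rev lessThan_atLeast0)

lemma degree_gbinom_poly: "degree (gbinom_poly j) \<le> j"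
proof -
  have "degree (\<Prod>i<j. [:- real i, 1:]) \<le> sum (degree \<circ> (\<lambda>i. [:- real i, 1:])) {..<j}"
    by (rule degree_prod_sum_le) simp
  then show ?thesis by (simp add: gbinom_poly_def)
qed

lemma degree_smult_gbinom_poly: "j \<le> p \<Longrightarrow> degree (smult c (gbinom_poly j)) \<le> p"
  using degree_smult_le[of c "gbinom_poly j"] degree_gbinom_poly[of j] by linarith

lemma summable_shifted_difference:
  fixes z :: "nat \<Rightarrow> real"
  assumes "convergent z"
  shows "summable (\<lambda>i. z (i + K) - z i)"
proof (induction K)
  case (Suc K)
  obtain L where "z \<longlonglongrightarrow> L" using assms by (auto simp: convergent_def)
  then have "(\<lambda>i. z (i + K)) \<longlonglongrightarrow> L" by (rule LIMSEQ_ignore_initial_segment)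
  then have "summable (\<lambda>i. z (Suc i + K) - z (i + K))" by (rule telescope_summable)
  from summable_add[OF this Suc] show ?case by simp
qed simp

section \<open>The principal indefinite sum\<close>

lemma C_class_iff:
  "f \<in> C_class r \<longleftrightarrow>
    (\<forall>k<r. \<forall>x>0. ((deriv ^^ k) f has_real_derivative (deriv ^^ Suc k) f x) (at x)) \<and>
    continuous_on {0<..} ((deriv ^^ r) f)"
  by (simp add: C_class_def DERIV_deriv_iff_field_differentiable)

text \<open>
  With \<open>r \<le> p\<close> each of the derivatives \<open>g, g', \<dots>, g\<^sup>(\<^sup>r\<^sup>)\<close> inherits a sign condition from \<open>g\<close>,
  where the \<open>k\<close>-th one has \<open>p - k\<close> in place of \<open>p\<close>.
\<close>

locale admissible_summand =
  fixes g :: "real \<Rightarrow> real" and r p :: nat and s a :: real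
  assumes r_le_p: "r \<le> p"
    and g_C: "g \<in> C_class r" and g_D: "g \<in> D_class p" and g_K: "g \<in> K_class p"
    and abs_s: "\<bar>s\<bar> = 1" and a_pos: "a > 0" and g_sign: "dd_sign s (p + 2) {a..} g"
begin

lemma g_deriv:
  "k < r \<Longrightarrow> 0 < x \<Longrightarrow> ((deriv ^^ k) g has_real_derivative (deriv ^^ Suc k) g x) (at x)"
  using g_C by (simp add: C_class_iff)

lemma g_deriv_shift:
  "k < r \<Longrightarrow> 0 < x + c \<Longrightarrow>
    ((\<lambda>x. (deriv ^^ k) g (x + c)) has_real_derivative (deriv ^^ Suc k) g (x + c)) (at x)"
  using g_deriv[of k "x + c"] by (simp add: DERIV_shift)

lemma g_deriv_continuous: "k \<le> r \<Longrightarrow> continuous_on {0<..} ((deriv ^^ k) g)"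
proof (cases "k = r")
  case True
  then show ?thesis using g_C by (simp add: C_class_iff)
next
  case False
  assume "k \<le> r"
  then show ?thesis
    using False g_deriv[of k] by (intro continuous_at_imp_continuous_on) (auto intro: DERIV_isCont)
qed

lemma g_deriv_sign: "k \<le> r \<Longrightarrow> dd_sign s (p - k + 2) {a..} ((deriv ^^ k) g)"
  by (rule dd_sign_higher_deriv[OF g_sign]) (use r_le_p a_pos in \<open>simp_all add: g_deriv del: funpow.simps\<close>)

text \<open>
  The function \<open>s \<Delta>\<^sup>p g\<close> increases to \<open>0\<close>, so it is bounded above. By the mean value theorem each
  difference of order \<open>p - k\<close> of the \<open>k\<close>-th derivative equals a difference of order \<open>p - k - 1\<close> of the
  next derivative at a point to the right, and monotonicity brings this point back to \<open>x\<close>.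
\<close>

lemma fwd_diff_g_deriv_bounded:
  assumes "k \<le> r"
  shows "\<exists>B. \<forall>x\<ge>a. s * (fwd_diff ^^ (p - k)) ((deriv ^^ k) g) x \<le> B"
  using assms
proof (induction k)
  case 0
  have "s * (fwd_diff ^^ p) g x \<le> 0" if x: "a \<le> x" for x
  proof (rule LIMSEQ_le_const)
    show "(\<lambda>n. s * (fwd_diff ^^ p) g (real n)) \<longlonglongrightarrow> 0"
      using g_D by (auto simp: D_class_def intro!: tendsto_mult_right_zero)
    have "s * (fwd_diff ^^ p) g x \<le> s * (fwd_diff ^^ p) g (real n)" if "nat \<lceil>x\<rceil> \<le> n" for n
      using that x by (intro dd_sign_fwd_diff_mono[OF g_sign]) linarith+
    then show "\<exists>N. \<forall>n\<ge>N. s * (fwd_diff ^^ p) g x \<le> s * (fwd_diff ^^ p) g (real n)" by blast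
  qed
  then show ?case by auto
next
  case (Suc k)
  then obtain B where B: "\<And>x. a \<le> x \<Longrightarrow> s * (fwd_diff ^^ (p - k)) ((deriv ^^ k) g) x \<le> B"
    by auto
  define d where "d = p - Suc k"
  have d: "p - k = Suc d" using Suc.prems r_le_p by (simp add: d_def)
  have "s * (fwd_diff ^^ d) ((deriv ^^ Suc k) g) x \<le> B" if x: "a \<le> x" for x
  proof -
    have "\<exists>z. x < z \<and> z < x + 1 \<and>
        (fwd_diff ^^ d) ((deriv ^^ k) g) (x + 1) - (fwd_diff ^^ d) ((deriv ^^ k) g) x
        = (x + 1 - x) * (fwd_diff ^^ d) ((deriv ^^ Suc k) g) z"
      using Suc.prems a_pos x
      by (intro MVT2 fwd_diff_deriv[of a] g_deriv) auto
    then obtain z where z: "x < z" "(fwd_diff ^^ Suc d) ((deriv ^^ k) g) x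
        = (fwd_diff ^^ d) ((deriv ^^ Suc k) g) z"
      by (auto simp: fwd_diff_def[of "(fwd_diff ^^ d) _"])
    have "s * (fwd_diff ^^ d) ((deriv ^^ Suc k) g) x \<le> s * (fwd_diff ^^ d) ((deriv ^^ Suc k) g) z"
      using g_deriv_sign[OF Suc.prems] x z(1) unfolding d_def by (intro dd_sign_fwd_diff_mono) auto
    also have "\<dots> \<le> B" using B[OF x] z(2) d by simp
    finally show ?thesis .
  qed
  then show ?case by (auto simp: d_def)
qed

lemma fwd_diff_g_deriv_convergent:
  assumes k: "k \<le> r" and N: "a \<le> real N"
  shows "convergent (\<lambda>i. s * (fwd_diff ^^ (p - k)) ((deriv ^^ k) g) (real (i + N)))"
proof -
  obtain B where "\<And>x. a \<le> x \<Longrightarrow> s * (fwd_diff ^^ (p - k)) ((deriv ^^ k) g) x \<le> B"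
    using fwd_diff_g_deriv_bounded[OF k] by blast
  then have "\<forall>i. s * (fwd_diff ^^ (p - k)) ((deriv ^^ k) g) (real (i + N)) \<le> B"
    using N by simp
  moreover have "incseq (\<lambda>i. s * (fwd_diff ^^ (p - k)) ((deriv ^^ k) g) (real (i + N)))"
    using N by (intro incseq_SucI dd_sign_fwd_diff_mono[OF g_deriv_sign[OF k]]) auto
  ultimately obtain L where
    "(\<lambda>i. s * (fwd_diff ^^ (p - k)) ((deriv ^^ k) g) (real (i + N))) \<longlonglongrightarrow> L"
    using incseq_convergent by blast
  then show ?thesis by (auto simp: convergent_def)
qed

text \<open>
  This is the Newton interpolation polynomial of the translate \<open>x \<mapsto> g (x + n)\<close> at the nodes
  \<open>0, \<dots>, p\<close>.
\<close>

definition newton_poly :: "nat \<Rightarrow> real poly" where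
  "newton_poly n = (\<Sum>j\<le>p. smult ((fwd_diff ^^ j) g (real n)) (gbinom_poly j))"

definition newton_error :: "nat \<Rightarrow> nat \<Rightarrow> real \<Rightarrow> real" where
  "newton_error k n x = (deriv ^^ k) g (x + real n) - poly ((pderiv ^^ k) (newton_poly n)) x"

lemma degree_newton_poly: "degree (newton_poly n) \<le> p"
  unfolding newton_poly_def
  by (intro degree_sum_le degree_smult_gbinom_poly) auto

lemma newton_error_node: "i \<le> p \<Longrightarrow> newton_error 0 n (real i) = 0"
  using newton_forward_difference[of i p g "real n"]
  by (simp add: newton_error_def newton_poly_def poly_sum mult.commute add.commute)

lemma newton_error_deriv:
  assumes "k < r" "n \<ge> 1" "0 \<le> x"
  shows "(newton_error k n has_real_derivative newton_error (Suc k) n x) (at x)"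
proof -
  have "((\<lambda>x. (deriv ^^ k) g (x + real n) - poly ((pderiv ^^ k) (newton_poly n)) x)
      has_real_derivative (deriv ^^ Suc k) g (x + real n)
        - poly (pderiv ((pderiv ^^ k) (newton_poly n))) x) (at x)"
    using assms by (intro DERIV_diff g_deriv_shift poly_DERIV) auto
  then show ?thesis by (simp add: newton_error_def[abs_def])
qed

lemma newton_error_zeros:
  assumes "k \<le> r" "n \<ge> 1"
  shows "\<exists>T. finite T \<and> card T = p - k + 1 \<and> T \<subseteq> {0..real p} \<and> (\<forall>x\<in>T. newton_error k n x = 0)"
  using assms(1)
proof (induction k)
  case 0
  show ?case
    using newton_error_node[of _ n]
    by (intro exI[of _ "real ` {..p}"]) (auto simp: card_image)
next
  case (Suc k)
  then obtain T where T: "finite T" "card T = Suc (p - k)" "T \<subseteq> {0..real p}"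
      "\<And>x. x \<in> T \<Longrightarrow> newton_error k n x = 0"
    by auto
  have "p - k = p - Suc k + 1" using Suc.prems r_le_p by simp
  then show ?case
    using rolle_finite[OF T] newton_error_deriv[of k n] Suc.prems assms(2) by auto
qed

text \<open>
  By Rolle's theorem the \<open>k\<close>-th derivative of the error vanishes at \<open>p - k + 1\<close> points. It is therefore
  itself the error of an interpolation, of the \<open>k\<close>-th derivative of \<open>g\<close> by a polynomial of degree
  \<open>p - k\<close>, and the sign condition for this derivative applies.
\<close>

lemma newton_error_bound:
  fixes M :: nat
  defines "D \<equiv> \<lambda>k x. s * (fwd_diff ^^ (p - k)) ((deriv ^^ k) g) x"
  assumes k: "k \<le> r" and n: "a + real p \<le> real n" "n \<ge> 1" and M: "p \<le> M"
    and x: "0 \<le> x" "x \<le> real M"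
  shows "\<bar>newton_error k n x\<bar> \<le>
    real M ^ (p - k) * ((D k (real M + real n) - D k (real n - real (p - k))) / fact (p - k))"
proof -
  define h where "h x = (deriv ^^ k) g (x + real n)" for x
  obtain T where T: "finite T" "card T = p - k + 1" "T \<subseteq> {0..real p}"
      "\<And>x. x \<in> T \<Longrightarrow> newton_error k n x = 0"
    using newton_error_zeros[OF k n(2)] by blast
  have "dd_sign s (p - k + 2) {a - real n..} h"
    unfolding dd_sign_def
  proof (intro allI impI, elim conjE)
    fix S assume S: "finite S" "card S = p - k + 2" "S \<subseteq> {a - real n..}"
    have "h = (\<lambda>x. (deriv ^^ k) g (real n + x))"
      by (simp add: fun_eq_iff h_def add.commute)
    then have "dd h S = dd ((deriv ^^ k) g) ((+) (real n) ` S)"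
      by (simp only: dd_shift)
    moreover have "card ((+) (real n) ` S) = p - k + 2" using S by (simp add: card_image)
    moreover have "(+) (real n) ` S \<subseteq> {a..}" using S by auto
    ultimately show "0 \<le> s * dd h S"
      using dd_signD[OF g_deriv_sign[OF k], of "(+) (real n) ` S"] S by simp
  qed
  then have "\<bar>h x - poly ((pderiv ^^ k) (newton_poly n)) x\<bar> \<le> (real M - 0) ^ (p - k) *
    ((s * (fwd_diff ^^ (p - k)) h (real M) - s * (fwd_diff ^^ (p - k)) h (0 - real (p - k)))
      / fact (p - k))"
  proof (rule interpolation_error_bound[OF _ abs_s _ T(1,2)])
    show "degree ((pderiv ^^ k) (newton_poly n)) \<le> p - k"
      using degree_newton_poly[of n] by (simp add: degree_higher_pderiv diff_le_mono)
    show "T \<subseteq> {0..real M}" using T(3) M by fastforce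
    show "h t = poly ((pderiv ^^ k) (newton_poly n)) t" if "t \<in> T" for t
      using T(4)[OF that] by (simp add: newton_error_def h_def)
  qed (use x n in auto)
  then show ?thesis
    by (simp add: newton_error_def h_def[abs_def] fwd_diff_shift D_def)
qed

text \<open>
  The increments of \<open>n \<mapsto> Sigma_approx p g x n\<close> are, up to sign, the interpolation errors. Summing them
  from \<open>n = 1\<close>, the first index that uses only values of \<open>g\<close> on the positive axis, and differentiating
  \<open>k\<close> times under the sum gives this formula.
\<close>

definition limit_deriv :: "nat \<Rightarrow> real \<Rightarrow> real" where
  "limit_deriv k x =
     poly ((pderiv ^^ k) (\<Sum>j=1..p. smult ((fwd_diff ^^ (j - 1)) g 1) (gbinom_poly j))) x
     - (deriv ^^ k) g x - (\<Sum>i. newton_error k (Suc i) x)"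

text \<open>
  For \<open>x\<close> in \<open>{0..M}\<close> and large \<open>n\<close> the \<open>n\<close>-th term is at most a constant times \<open>z (n + M + p - k) - z n\<close> for a
  sequence \<open>z\<close> that is monotone and bounded. These majorants telescope, so the Weierstrass test applies.
\<close>

lemma newton_error_uniform_limit:
  fixes M :: nat
  assumes k: "k \<le> r" and M: "p \<le> M"
  shows "uniform_limit {0..real M} (\<lambda>n x. \<Sum>i<n. newton_error k (Suc i) x)
      (\<lambda>x. \<Sum>i. newton_error k (Suc i) x) sequentially"
    and "x \<in> {0..real M} \<Longrightarrow> summable (\<lambda>i. newton_error k (Suc i) x)"
proof -
  define N where "N = nat \<lceil>a\<rceil>"
  have N: "a \<le> real N" using a_pos by (simp add: N_def real_nat_ceiling_ge)
  define d where "d = p - k"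
  have d: "d \<le> p" by (simp add: d_def)
  define D where "D x = s * (fwd_diff ^^ d) ((deriv ^^ k) g) x" for x
  define z where "z i = D (real (i + N))" for i
  define Q where "Q i = real M ^ d * ((D (real M + real (Suc i)) - D (real (Suc i) - real d)) / fact d)"
    for i
  have bound: "\<bar>newton_error k (Suc i) x\<bar> \<le> Q i" if "x \<in> {0..real M}" "N + p \<le> i" for i x
    using newton_error_bound[OF k, of "Suc i" M x] that N M by (simp add: Q_def D_def d_def)
  have "convergent (\<lambda>i. z (i + Suc (p - d)))"
    using fwd_diff_g_deriv_convergent[OF k, of "Suc (p - d) + N"] N
    by (simp add: z_def D_def d_def add.assoc)
  then have "summable (\<lambda>i. z (i + (M + d) + Suc (p - d)) - z (i + Suc (p - d)))"
    by (rule summable_shifted_difference)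
  then have "summable (\<lambda>i. real M ^ d *
      ((z (i + (M + d) + Suc (p - d)) - z (i + Suc (p - d))) / fact d))"
    by (intro summable_mult summable_divide)
  moreover have "real M ^ d * ((z (i + (M + d) + Suc (p - d)) - z (i + Suc (p - d))) / fact d)
      = Q (i + (N + p))" for i
    using d by (simp add: Q_def z_def algebra_simps)
  ultimately have "summable (\<lambda>i. Q (i + (N + p)))" by (simp only:)
  then have Q: "summable Q" by (simp only: summable_iff_shift)
  show "uniform_limit {0..real M} (\<lambda>n x. \<Sum>i<n. newton_error k (Suc i) x)
      (\<lambda>x. \<Sum>i. newton_error k (Suc i) x) sequentially"
    using bound
    by (intro Weierstrass_m_test_ev[OF _ Q] eventually_sequentiallyI[of "N + p"]) auto
  show "summable (\<lambda>i. newton_error k (Suc i) x)" if "x \<in> {0..real M}"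
    using bound[OF that]
    by (intro summable_comparison_test[OF _ Q]) auto
qed

lemma exists_nat_bound: "\<exists>M\<ge>p. x < real M"
  using reals_Archimedean2[of "max x (real p)"] by (auto intro: less_imp_le)

lemma newton_error_summable:
  assumes "k \<le> r" "0 \<le> x"
  shows "summable (\<lambda>i. newton_error k (Suc i) x)"
proof -
  obtain M where "p \<le> M" "x < real M" using exists_nat_bound by blast
  then show ?thesis using newton_error_uniform_limit(2)[of k M x] assms by simp
qed

lemma limit_deriv_has_derivative:
  assumes k: "k < r" and x: "0 < x"
  shows "(limit_deriv k has_real_derivative limit_deriv (Suc k) x) (at x)"
proof -
  obtain M where M: "p \<le> M" "x < real M" using exists_nat_bound by blast
  have "((\<lambda>x. \<Sum>i. newton_error k (Suc i) x) has_real_derivative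
      (\<Sum>i. newton_error (Suc k) (Suc i) x)) (at x)"
  proof (rule has_field_derivative_series'(2)[of "{0..real M}" _ _ x])
    show "(newton_error k (Suc n) has_real_derivative newton_error (Suc k) (Suc n) y)
        (at y within {0..real M})" if "y \<in> {0..real M}" for n y
      using newton_error_deriv[OF k, of "Suc n" y] that by (auto intro: has_field_derivative_at_within)
    show "uniformly_convergent_on {0..real M} (\<lambda>n x. \<Sum>i<n. newton_error (Suc k) (Suc i) x)"
      using newton_error_uniform_limit(1)[of "Suc k" M] k M by (auto simp: uniformly_convergent_on_def)
    show "summable (\<lambda>n. newton_error k (Suc n) x)"
      using newton_error_summable k x by simp
  qed (use x M in auto)
  from DERIV_diff[OF DERIV_diff[OF poly_DERIV g_deriv[OF k x]] this] show ?thesis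
    by (simp add: limit_deriv_def[abs_def])
qed

lemma newton_error_continuous:
  assumes "k \<le> r" "n \<ge> 1"
  shows "continuous_on {0..} (newton_error k n)"
  unfolding newton_error_def using assms
  by (intro continuous_intros continuous_on_compose2[OF g_deriv_continuous]) auto

lemma limit_deriv_continuous: "continuous_on {0<..} (limit_deriv r)"
proof -
  have "isCont (\<lambda>x. \<Sum>i. newton_error r (Suc i) x) x" if x: "0 < x" for x
  proof -
    obtain M where M: "p \<le> M" "x < real M" using exists_nat_bound by blast
    have "continuous_on {0..real M} (\<lambda>x. \<Sum>i. newton_error r (Suc i) x)"
    proof (rule uniform_limit_theorem[OF _ newton_error_uniform_limit(1)[OF order_refl M(1)]])
      have "continuous_on {0..real M} (\<lambda>x. \<Sum>i<n. newton_error r (Suc i) x)" for n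
        by (intro continuous_on_sum continuous_on_subset[OF newton_error_continuous]) auto
      then show "\<forall>\<^sub>F n in sequentially.
          continuous_on {0..real M} (\<lambda>x. \<Sum>i<n. newton_error r (Suc i) x)" by simp
    qed simp
    then show ?thesis using x M by (simp add: continuous_on_interior)
  qed
  then have "continuous_on {0<..} (\<lambda>x. \<Sum>i. newton_error r (Suc i) x)"
    by (auto intro: continuous_at_imp_continuous_on)
  then show ?thesis
    unfolding limit_deriv_def by (intro continuous_intros g_deriv_continuous order_refl)
qed

lemma Sigma_approx_Suc:
  "Sigma_approx p g x (Suc n) =
    (\<Sum>j=1..p. (x gchoose j) * (fwd_diff ^^ (j - 1)) g 1) - g x - (\<Sum>i<n. newton_error 0 (Suc i) x)"
proof (induction n)
  case 0
  then show ?case by (simp add: Sigma_approx_def)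
next
  case (Suc n)
  have step: "(x gchoose j) * (fwd_diff ^^ (j - 1)) g (real (Suc (Suc n)))
      = (x gchoose j) * (fwd_diff ^^ (j - 1)) g (real (Suc n))
        + (x gchoose j) * (fwd_diff ^^ j) g (real (Suc n))" if "j \<in> {1..p}" for j
  proof -
    have "j = Suc (j - 1)" using that by simp
    then have "(fwd_diff ^^ j) g (real (Suc n))
        = (fwd_diff ^^ (j - 1)) g (real (Suc n) + 1) - (fwd_diff ^^ (j - 1)) g (real (Suc n))"
      by (metis (no_types, lifting) funpow.simps(2) comp_apply fwd_diff_def)
    then have "(fwd_diff ^^ (j - 1)) g (real (Suc (Suc n)))
        = (fwd_diff ^^ (j - 1)) g (real (Suc n)) + (fwd_diff ^^ j) g (real (Suc n))"
      by (simp add: add.commute)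
    then show ?thesis by (simp only: distrib_left)
  qed
  have "{..p} = insert 0 {1..p}" by auto
  then have "poly (newton_poly (Suc n)) x
      = g (real (Suc n)) + (\<Sum>j=1..p. (x gchoose j) * (fwd_diff ^^ j) g (real (Suc n)))"
    by (simp add: newton_poly_def poly_sum mult.commute)
  then have "newton_error 0 (Suc n) x = g (x + real (Suc n)) - g (real (Suc n))
      - (\<Sum>j=1..p. (x gchoose j) * (fwd_diff ^^ j) g (real (Suc n)))"
    by (simp add: newton_error_def)
  moreover have "(\<Sum>j=1..p. (x gchoose j) * (fwd_diff ^^ (j - 1)) g (real (Suc (Suc n))))
      = (\<Sum>j=1..p. (x gchoose j) * (fwd_diff ^^ (j - 1)) g (real (Suc n)))
        + (\<Sum>j=1..p. (x gchoose j) * (fwd_diff ^^ j) g (real (Suc n)))"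
    by (simp only: step sum.distrib cong: sum.cong)
  moreover have "(\<Sum>k=1..<Suc (Suc n). g (real k) - g (x + real k))
      = (\<Sum>k=1..<Suc n. g (real k) - g (x + real k)) + (g (real (Suc n)) - g (x + real (Suc n)))"
    by simp
  ultimately have "Sigma_approx p g x (Suc (Suc n))
      = Sigma_approx p g x (Suc n) - newton_error 0 (Suc n) x"
    unfolding Sigma_approx_def by linarith
  then show ?case using Suc.IH by simp
qed

lemma Sigma_approx_tendsto:
  assumes "0 < x"
  shows "Sigma_approx p g x \<longlonglongrightarrow> Sigma_fun g x" and "Sigma_fun g x = limit_deriv 0 x"
proof -
  have "(\<lambda>n. \<Sum>i<n. newton_error 0 (Suc i) x) \<longlonglongrightarrow> (\<Sum>i. newton_error 0 (Suc i) x)"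
    using newton_error_summable[of 0 x] assms by (auto intro: summable_LIMSEQ)
  then have "(\<lambda>n. Sigma_approx p g x (Suc n)) \<longlonglongrightarrow> limit_deriv 0 x"
    unfolding Sigma_approx_Suc limit_deriv_def
    by (auto intro!: tendsto_diff simp: poly_sum mult.commute)
  then have lim: "Sigma_approx p g x \<longlonglongrightarrow> limit_deriv 0 x" by (rule LIMSEQ_imp_Suc)
  then show "Sigma_fun g x = limit_deriv 0 x"
    using Sigma_fun_eq[of g p x] g_D g_K by (simp add: limI)
  then show "Sigma_approx p g x \<longlonglongrightarrow> Sigma_fun g x" using lim by simp
qed

lemma Sigma_fun_higher_deriv:
  assumes "k \<le> r" "0 < x"
  shows "(deriv ^^ k) (Sigma_fun g) x = limit_deriv k x"
  using assms
proof (induction k arbitrary: x)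
  case 0
  then show ?case using Sigma_approx_tendsto(2) by simp
next
  case (Suc k)
  have "((deriv ^^ k) (Sigma_fun g) has_real_derivative limit_deriv (Suc k) x) (at x)"
  proof (rule has_field_derivative_transform_within_open[where S = "{0<..}"])
    show "(limit_deriv k has_real_derivative limit_deriv (Suc k) x) (at x)"
      using Suc.prems by (intro limit_deriv_has_derivative) auto
  qed (use Suc in auto)
  then show ?case by (simp add: DERIV_imp_deriv)
qed

lemma Sigma_fun_in_C_class: "Sigma_fun g \<in> C_class r"
  unfolding C_class_iff
proof (intro conjI allI impI)
  fix k x assume k: "k < r" and x: "0 < (x::real)"
  have "((deriv ^^ k) (Sigma_fun g) has_real_derivative limit_deriv (Suc k) x) (at x)"
  proof (rule has_field_derivative_transform_within_open[where S = "{0<..}"])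
    show "(limit_deriv k has_real_derivative limit_deriv (Suc k) x) (at x)"
      using k x by (rule limit_deriv_has_derivative)
  qed (use k x Sigma_fun_higher_deriv[of k] in auto)
  then show "((deriv ^^ k) (Sigma_fun g) has_real_derivative (deriv ^^ Suc k) (Sigma_fun g) x) (at x)"
    using Sigma_fun_higher_deriv[of "Suc k" x] k x by simp
next
  show "continuous_on {0<..} ((deriv ^^ r) (Sigma_fun g))"
    by (rule continuous_on_eq[OF limit_deriv_continuous]) (simp add: Sigma_fun_higher_deriv)
qed

lemma Sigma_approx_step:
  assumes "n \<ge> 1"
  shows "Sigma_approx p g (x + 1) n - Sigma_approx p g x n =
    g x - newton_error 0 n x - (x gchoose p) * (fwd_diff ^^ p) g (real n)"
proof -
  obtain n' where n': "n = Suc n'" using assms by (cases n) auto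
  have "(\<Sum>k=1..<n. g (real k) - g (x + 1 + real k)) - (\<Sum>k=1..<n. g (real k) - g (x + real k))
      = (\<Sum>k=1..<n. g (x + real k) - g (x + real (Suc k)))"
    by (simp add: sum_subtractf[symmetric] add.assoc)
  also have "\<dots> = g (x + 1) - g (x + real n)"
    unfolding n' by (induction n') (auto simp: add.commute)
  finally have 1: "(\<Sum>k=1..<n. g (real k) - g (x + 1 + real k))
      = (\<Sum>k=1..<n. g (real k) - g (x + real k)) + g (x + 1) - g (x + real n)"
    by simp
  have "(\<Sum>j=1..p. (x + 1 gchoose j) * (fwd_diff ^^ (j - 1)) g (real n))
      = (\<Sum>j<p. (x + 1 gchoose Suc j) * (fwd_diff ^^ j) g (real n))"
    by (rule sum.reindex_bij_witness[of _ Suc "\<lambda>j. j - 1"]) auto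
  also have "\<dots> = (\<Sum>j<p. (x gchoose j) * (fwd_diff ^^ j) g (real n))
      + (\<Sum>j<p. (x gchoose Suc j) * (fwd_diff ^^ j) g (real n))"
    by (simp add: gbinomial_Suc_Suc distrib_right sum.distrib)
  also have "(\<Sum>j<p. (x gchoose Suc j) * (fwd_diff ^^ j) g (real n))
      = (\<Sum>j=1..p. (x gchoose j) * (fwd_diff ^^ (j - 1)) g (real n))"
    by (rule sum.reindex_bij_witness[of _ "\<lambda>j. j - 1" Suc]) auto
  also have "(\<Sum>j<p. (x gchoose j) * (fwd_diff ^^ j) g (real n))
      = poly (newton_poly n) x - (x gchoose p) * (fwd_diff ^^ p) g (real n)"
    by (simp add: newton_poly_def poly_sum mult.commute lessThan_Suc_atMost[symmetric])
  finally show ?thesis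
    unfolding Sigma_approx_def newton_error_def 1 by simp
qed

lemma Sigma_fun_step:
  assumes x: "0 < x"
  shows "Sigma_fun g (x + 1) = Sigma_fun g x + g x"
proof -
  have lim: "(\<lambda>n. Sigma_approx p g (x + 1) (Suc n) - Sigma_approx p g x (Suc n))
      \<longlonglongrightarrow> Sigma_fun g (x + 1) - Sigma_fun g x"
    using x by (intro tendsto_diff LIMSEQ_Suc Sigma_approx_tendsto) auto
  have "(\<lambda>n. newton_error 0 (Suc n) x) \<longlonglongrightarrow> 0"
    using newton_error_summable[of 0 x] x by (intro summable_LIMSEQ_zero) auto
  moreover have "(\<lambda>n. (x gchoose p) * (fwd_diff ^^ p) g (real (Suc n))) \<longlonglongrightarrow> 0"
    using LIMSEQ_Suc[of "\<lambda>n. (fwd_diff ^^ p) g (real n)" 0] g_D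
    by (intro tendsto_mult_right_zero) (simp add: D_class_def)
  ultimately have "(\<lambda>n. g x - newton_error 0 (Suc n) x
      - (x gchoose p) * (fwd_diff ^^ p) g (real (Suc n))) \<longlonglongrightarrow> g x - 0 - 0"
    by (intro tendsto_diff tendsto_const)
  then have "(\<lambda>n. Sigma_approx p g (x + 1) (Suc n) - Sigma_approx p g x (Suc n)) \<longlonglongrightarrow> g x"
    by (simp add: Sigma_approx_step)
  from LIMSEQ_unique[OF lim this] show ?thesis by simp
qed

lemma Sigma_fun_deriv_step:
  assumes "k \<le> r" "0 < x"
  shows "(deriv ^^ k) (Sigma_fun g) (x + 1) - (deriv ^^ k) (Sigma_fun g) x = (deriv ^^ k) g x"
  using assms
proof (induction k arbitrary: x)
  case 0
  then show ?case using Sigma_fun_step by simp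
next
  case (Suc k)
  have D: "((deriv ^^ k) (Sigma_fun g) has_real_derivative (deriv ^^ Suc k) (Sigma_fun g) y) (at y)"
    if "0 < y" for y
    using Sigma_fun_in_C_class Suc.prems(1) that by (simp add: C_class_iff)
  have "((\<lambda>x. (deriv ^^ k) (Sigma_fun g) (x + 1)) has_real_derivative
      (deriv ^^ Suc k) (Sigma_fun g) (x + 1)) (at x)"
    using D[of "x + 1"] Suc.prems(2) by (simp add: DERIV_shift)
  note diff = DERIV_diff[OF this D[OF Suc.prems(2)]]
  have "((deriv ^^ k) g has_real_derivative
      (deriv ^^ Suc k) (Sigma_fun g) (x + 1) - (deriv ^^ Suc k) (Sigma_fun g) x) (at x)"
    by (rule has_field_derivative_transform_within_open[OF diff, where S = "{0<..}"])
       (use Suc.IH Suc.prems in simp_all)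
  from DERIV_unique[OF this g_deriv[of k x]] show ?case using Suc.prems by simp
qed

text \<open>
  Each \<open>Sigma_approx p g\<close> is a polynomial of degree at most \<open>p\<close>, which \<open>p + 2\<close> nodes annihilate, minus a
  sum of translates of \<open>g\<close> to the right. Hence its divided differences have the sign opposite to those
  of \<open>g\<close>, and so does the limit.
\<close>

lemma Sigma_fun_dd_sign: "dd_sign (- s) (p + 2) {a..} (Sigma_fun g)"
  unfolding dd_sign_def
proof (intro allI impI, elim conjE)
  fix S :: "real set" assume S: "finite S" "card S = p + 2" "S \<subseteq> {a..}"
  have approx: "0 \<le> - s * dd (\<lambda>x. Sigma_approx p g x (Suc n)) S" for n
  proof -
    define Q where "Q = [:\<Sum>k=1..<Suc n. g (real k):]
        + (\<Sum>j=1..p. smult ((fwd_diff ^^ (j - 1)) g (real (Suc n))) (gbinom_poly j))"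
    have deg: "degree Q \<le> p"
      unfolding Q_def
      by (intro degree_add_le degree_sum_le degree_smult_gbinom_poly) auto
    have "Sigma_approx p g x (Suc n) = poly Q x - (\<Sum>k<Suc n. g (real k + x))" for x
    proof -
      have "{..<Suc n} = insert 0 {1..<Suc n}" by auto
      then show ?thesis
        by (simp add: Sigma_approx_def Q_def poly_sum sum_subtractf mult.commute add.commute)
    qed
    then have "dd (\<lambda>x. Sigma_approx p g x (Suc n)) S
        = dd (poly Q) S - (\<Sum>k<Suc n. dd g ((+) (real k) ` S))"
      by (simp add: dd_diff dd_sum dd_shift del: sum.lessThan_Suc)
    also have "dd (poly Q) S = 0" using deg S by (intro dd_poly) simp
    finally have "- s * dd (\<lambda>x. Sigma_approx p g x (Suc n)) S
        = (\<Sum>k<Suc n. s * dd g ((+) (real k) ` S))"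
      by (simp add: sum_distrib_left sum_negf del: sum.lessThan_Suc)
    also have "\<dots> \<ge> 0"
      using S by (intro sum_nonneg dd_signD[OF g_sign]) (auto simp: card_image)
    finally show ?thesis .
  qed
  have "(\<lambda>n. - s * dd (\<lambda>x. Sigma_approx p g x (Suc n)) S) \<longlonglongrightarrow> - s * dd (Sigma_fun g) S"
    unfolding dd_def using S a_pos
    by (intro tendsto_mult tendsto_const tendsto_sum tendsto_divide LIMSEQ_Suc
        Sigma_approx_tendsto(1)) (auto dest: subsetD)
  then show "0 \<le> - s * dd (Sigma_fun g) S"
    by (rule LIMSEQ_le_const) (use approx in auto)
qed

lemma Sigma_fun_deriv_eventually_constant_sign:
  "\<exists>s' b. \<bar>s'\<bar> = 1 \<and> 0 < b \<and> (\<forall>x\<ge>b. 0 \<le> s' * (deriv ^^ r) (Sigma_fun g) x)"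
proof -
  have "dd_sign (- s) (p - r + 2) {a..} ((deriv ^^ r) (Sigma_fun g))"
    using Sigma_fun_in_C_class a_pos r_le_p
    by (intro dd_sign_higher_deriv[OF Sigma_fun_dd_sign]) (auto simp: C_class_iff)
  then have "dd_sign (- s) (Suc (p - r + 1)) {a..} ((deriv ^^ r) (Sigma_fun g))" by simp
  from dd_sign_eventually_constant_sign[OF this] obtain s' b where
    "\<bar>s'\<bar> = 1" "a \<le> b" "\<forall>x\<ge>b. 0 \<le> s' * (deriv ^^ r) (Sigma_fun g) x"
    using abs_s by auto
  then show ?thesis using a_pos by (intro exI[of _ s'] exI[of _ b]) auto
qed

end

section \<open>Bernoulli polynomials\<close>

lemma bernpoly_0 [simp]: "bernpoly 0 x = 1"
  by (simp add: bernpoly_def)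

lemma bernpoly_at_0: "bernpoly n 0 = bernoulli n"
  by (simp add: bernpoly_def power_0_left if_distrib cong: if_cong)

lemma bernpoly_at_1: "bernpoly n 1 = bernoulli n + (if n = 1 then 1 else 0)"
proof (cases n)
  case (Suc m)
  have "bernpoly n 1 = (\<Sum>j\<le>n. real (n choose j) * bernoulli j)"
    unfolding bernpoly_def
    by (rule sum.reindex_bij_witness[of _ "\<lambda>j. n - j" "\<lambda>j. n - j"])
       (auto simp: binomial_symmetric[symmetric])
  also have "\<dots> = (\<Sum>j\<le>m. real ((m + 1) choose j) * bernoulli j) + bernoulli n"
    by (simp add: Suc)
  also have "\<dots> = 0 ^ m + bernoulli n"
    by (simp only: bernoulli_recurrence)
  finally show ?thesis by (simp add: Suc power_0_left)
qed simp

lemma bernpoly_1: "bernpoly 1 x = x - 1 / 2"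
  by (simp add: bernpoly_def)

lemma bernpoly_deriv:
  "(bernpoly (Suc n) has_real_derivative real (Suc n) * bernpoly n x) (at x)"
proof -
  have "((\<lambda>x. \<Sum>k\<le>Suc n. real (Suc n choose k) * bernoulli (Suc n - k) * x ^ k)
      has_real_derivative
      (\<Sum>k\<le>Suc n. real (Suc n choose k) * bernoulli (Suc n - k) * (real k * x ^ (k - 1)))) (at x)"
    by (intro DERIV_sum DERIV_cmult) (use DERIV_pow in simp)
  also have "(\<Sum>k\<le>Suc n. real (Suc n choose k) * bernoulli (Suc n - k) * (real k * x ^ (k - 1)))
      = (\<Sum>k\<le>n. real (Suc n choose Suc k) * bernoulli (n - k) * (real (Suc k) * x ^ k))"
    by (subst sum.atMost_Suc_shift) simp
  also have "\<dots> = (\<Sum>k\<le>n. real (Suc n) * (real (n choose k) * bernoulli (n - k) * x ^ k))"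
  proof (rule sum.cong)
    fix k
    have "Suc k * (Suc n choose Suc k) = Suc n * (n choose k)"
      by (rule Suc_times_binomial)
    then have "real (Suc k) * real (Suc n choose Suc k) = real (Suc n) * real (n choose k)"
      by (simp only: of_nat_mult[symmetric])
    then have "real (Suc k) * real (Suc n choose Suc k) * (bernoulli (n - k) * x ^ k)
        = real (Suc n) * real (n choose k) * (bernoulli (n - k) * x ^ k)"
      by (simp only:)
    then show "real (Suc n choose Suc k) * bernoulli (n - k) * (real (Suc k) * x ^ k)
        = real (Suc n) * (real (n choose k) * bernoulli (n - k) * x ^ k)"
      by (simp only: mult_ac)
  qed simp
  also have "\<dots> = real (Suc n) * bernpoly n x"
    by (simp add: bernpoly_def sum_distrib_left)
  finally show ?thesis by (simp add: bernpoly_def[abs_def])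
qed

text \<open>
  This proves identities between Bernoulli polynomials. By induction \<open>F (n + 1)\<close> has derivative zero
  and is constant; the constant is zero because it is, up to a nonzero factor, the slope of
  \<open>F (n + 2)\<close>, which takes the same value at \<open>0\<close> and \<open>1\<close>.
\<close>

lemma appell_sequence_zero:
  fixes F :: "nat \<Rightarrow> real \<Rightarrow> real"
  assumes F0: "\<And>x. F 0 x = 0"
    and deriv: "\<And>n x. (F (Suc n) has_real_derivative c n * F n x) (at x)"
    and c: "\<And>n. c n \<noteq> 0"
    and ends: "\<And>n. n \<ge> 2 \<Longrightarrow> F n 1 = F n 0"
  shows "F n x = 0"
proof (induction n arbitrary: x)
  case (Suc n)
  have const: "F (Suc n) y = F (Suc n) 0" for y
    using deriv[of n] Suc.IH by (intro DERIV_isconst_all[of "F (Suc n)"]) simp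
  have "\<exists>z. 0 < z \<and> z < 1 \<and> F (Suc (Suc n)) 1 - F (Suc (Suc n)) 0
      = (1 - 0) * (c (Suc n) * F (Suc n) z)"
    by (intro MVT2) (auto intro: deriv)
  then obtain z where "c (Suc n) * F (Suc n) z = 0"
    using ends[of "Suc (Suc n)"] by auto
  then have "F (Suc n) z = 0" using c by simp
  then show ?case using const[of x] const[of z] by simp
qed (rule F0)

lemma bernpoly_reflect: "bernpoly n (1 - x) = (- 1) ^ n * bernpoly n x"
proof -
  define F where "F n x = bernpoly n (1 - x) - (- 1) ^ n * bernpoly n x" for n x
  have "F n x = 0"
  proof (rule appell_sequence_zero[where F = F and c = "\<lambda>n. - real (Suc n)"])
    show "(F (Suc n) has_real_derivative - real (Suc n) * F n x) (at x)" for n x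
    proof -
      have "((\<lambda>x. bernpoly (Suc n) (1 - x)) has_real_derivative
          real (Suc n) * bernpoly n (1 - x) * (- 1)) (at x)"
        by (rule DERIV_chain2[OF bernpoly_deriv]) (auto intro!: derivative_eq_intros)
      from DERIV_diff[OF this DERIV_cmult[OF bernpoly_deriv, of "(- 1) ^ Suc n"]]
      show ?thesis unfolding F_def by (rule DERIV_cong) (simp add: algebra_simps)
    qed
    show "F n 1 = F n 0" if "n \<ge> 2" for n
      using that by (simp add: F_def bernpoly_at_0 bernpoly_at_1)
  qed (auto simp: F_def)
  then show ?thesis by (simp add: F_def)
qed

lemma bernpoly_duplication:
  "bernpoly n (x / 2) + bernpoly n ((x + 1) / 2) = 2 / 2 ^ n * bernpoly n x"
proof -
  define F where
    "F n x = bernpoly n (x / 2) + bernpoly n ((x + 1) / 2) - 2 / 2 ^ n * bernpoly n x" for n x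
  have "F n x = 0"
  proof (rule appell_sequence_zero[where F = F and c = "\<lambda>n. real (Suc n) / 2"])
    show "(F (Suc n) has_real_derivative real (Suc n) / 2 * F n x) (at x)" for n x
    proof -
      have "((\<lambda>x. bernpoly (Suc n) (x / 2)) has_real_derivative
          real (Suc n) * bernpoly n (x / 2) * (1 / 2)) (at x)"
        by (rule DERIV_chain2[OF bernpoly_deriv]) (auto intro!: derivative_eq_intros)
      moreover have "((\<lambda>x. bernpoly (Suc n) ((x + 1) / 2)) has_real_derivative
          real (Suc n) * bernpoly n ((x + 1) / 2) * (1 / 2)) (at x)"
        by (rule DERIV_chain2[OF bernpoly_deriv]) (auto intro!: derivative_eq_intros)
      ultimately have "((\<lambda>x. bernpoly (Suc n) (x / 2) + bernpoly (Suc n) ((x + 1) / 2))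
          has_real_derivative real (Suc n) * bernpoly n (x / 2) * (1 / 2)
            + real (Suc n) * bernpoly n ((x + 1) / 2) * (1 / 2)) (at x)"
        by (rule DERIV_add)
      from DERIV_diff[OF this DERIV_cmult[OF bernpoly_deriv, of "2 / 2 ^ Suc n"]]
      show ?thesis unfolding F_def by (rule DERIV_cong) (simp add: field_simps)
    qed
    show "F n 1 = F n 0" if "n \<ge> 2" for n
      using that by (simp add: F_def bernpoly_at_0 bernpoly_at_1)
  qed (auto simp: F_def)
  then show ?thesis by (simp add: F_def)
qed

lemma bernoulli_odd_eq_0:
  assumes "odd n" "n \<noteq> 1"
  shows "bernoulli n = 0"
  using bernpoly_reflect[of n 0] assms by (simp add: bernpoly_at_0 bernpoly_at_1)

lemma bernpoly_odd_half: "odd n \<Longrightarrow> bernpoly n (1 / 2) = 0"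
  using bernpoly_reflect[of n "1 / 2"] by simp

lemma bernpoly_half: "bernpoly n (1 / 2) = (2 / 2 ^ n - 1) * bernoulli n"
  using bernpoly_duplication[of n 0] by (simp add: bernpoly_at_0 algebra_simps)

lemma bernpoly_even_mono_from_odd:
  assumes odd: "\<And>t. 0 \<le> t \<Longrightarrow> t \<le> 1 / 2 \<Longrightarrow> 0 \<le> s * bernpoly (2 * q + 1) t"
    and "0 \<le> t" "t \<le> u" "u \<le> 1 / 2"
  shows "s * bernpoly (2 * q + 2) t \<le> s * bernpoly (2 * q + 2) u"
proof (rule DERIV_nonneg_imp_nondecreasing[OF \<open>t \<le> u\<close>])
  fix x assume x: "t \<le> x" "x \<le> u"
  have "((\<lambda>x. s * bernpoly (2 * q + 2) x) has_real_derivative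
      s * (real (2 * q + 2) * bernpoly (2 * q + 1) x)) (at x)"
    using DERIV_cmult[OF bernpoly_deriv[of "2 * q + 1" x], of s] by simp
  moreover have "0 \<le> s * (real (2 * q + 2) * bernpoly (2 * q + 1) x)"
    using mult_nonneg_nonneg[OF of_nat_0_le_iff[of "2 * q + 2"] odd[of x]] x assms(2,4)
    by (simp only: mult.left_commute[of s])
  ultimately show "\<exists>y. ((\<lambda>x. s * bernpoly (2 * q + 2) x) has_real_derivative y) (at x) \<and> y \<ge> 0"
    by blast
qed

text \<open>
  If \<open>s B\<close> with \<open>B\<close> of index \<open>2q + 1\<close> is nonnegative on \<open>[0, 1/2]\<close>, then \<open>s B\<close> of index \<open>2q + 2\<close>
  increases there, so \<open>s B\<close> of index \<open>2q + 3\<close> is convex. The latter vanishes at both ends by the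
  reflection formula, so it is nonpositive, and the sign alternates.
\<close>

lemma bernpoly_odd_sign:
  assumes "0 \<le> t" "t \<le> 1 / 2"
  shows "0 \<le> (- 1) ^ (q + 1) * bernpoly (2 * q + 1) t"
  using assms
proof (induction q arbitrary: t)
  case 0
  then show ?case by (simp add: bernpoly_1[simplified])
next
  case (Suc q)
  define s :: real where "s = (- 1) ^ (q + 1)"
  define G where "G t = s * bernpoly (2 * q + 3) t" for t
  define G' where "G' t = s * (real (2 * q + 3) * bernpoly (2 * q + 2) t)" for t
  have G': "(G has_real_derivative G' x) (at x)" for x
    unfolding G_def G'_def
    using DERIV_cmult[OF bernpoly_deriv[of "2 * q + 2" x], of s] by (simp add: eval_nat_numeral)
  have mono: "G' u \<le> G' v" if "0 \<le> u" "u \<le> v" "v \<le> 1 / 2" for u v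
  proof -
    have "s * bernpoly (2 * q + 2) u \<le> s * bernpoly (2 * q + 2) v"
      using Suc.IH that unfolding s_def by (intro bernpoly_even_mono_from_odd) auto
    then have "real (2 * q + 3) * (s * bernpoly (2 * q + 2) u)
        \<le> real (2 * q + 3) * (s * bernpoly (2 * q + 2) v)"
      by (rule mult_left_mono) simp
    then show ?thesis by (simp only: G'_def mult.left_commute[of s])
  qed
  have zeros: "G 0 = 0" "G (1 / 2) = 0"
    using bernoulli_odd_eq_0[of "2 * q + 3"] bernpoly_odd_half[of "2 * q + 3"]
    by (simp_all add: G_def bernpoly_at_0)
  have "G t \<le> 0"
  proof (rule ccontr)
    assume "\<not> G t \<le> 0"
    then have pos: "G t > 0" by simp
    with zeros have "t \<noteq> 0" "t \<noteq> 1 / 2" by (metis less_irrefl)+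
    with Suc.prems have t: "0 < t" "t < 1 / 2" by auto
    obtain u where u: "0 < u" "u < t" "G t - G 0 = (t - 0) * G' u"
      using MVT2[OF t(1), of G G'] G' by blast
    obtain v where v: "t < v" "v < 1 / 2" "G (1 / 2) - G t = (1 / 2 - t) * G' v"
      using MVT2[OF t(2), of G G'] G' by blast
    have "G' u > 0" using u pos zeros t by (simp add: zero_less_mult_iff)
    moreover have "(1 / 2 - t) * G' v < 0" using v(3) pos zeros by simp
    then have "G' v < 0" using t by (simp add: mult_less_0_iff)
    ultimately show False using mono[of u v] u v by simp
  qed
  then show ?case by (simp add: G_def s_def eval_nat_numeral)
qed

text \<open>
  By reflection it suffices to look at \<open>[0, 1/2]\<close>, where the polynomial is monotone. So its values lie
  between those at \<open>0\<close> and \<open>1/2\<close>, and by the duplication formula the value at \<open>1/2\<close> is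
  \<open>2\<^sup>1\<^sup>-\<^sup>2\<^sup>q - 1\<close> times the Bernoulli number, hence of smaller absolute value.
\<close>

lemma abs_bernpoly_even_le:
  assumes "q \<ge> 1" "0 \<le> t" "t \<le> 1"
  shows "\<bar>bernpoly (2 * q) t\<bar> \<le> \<bar>bernoulli (2 * q)\<bar>"
proof -
  have half: "\<bar>bernpoly (2 * q) t\<bar> \<le> \<bar>bernoulli (2 * q)\<bar>" if t: "0 \<le> t" "t \<le> 1 / 2" for t
  proof -
    obtain r where r: "q = Suc r" using assms(1) by (cases q) auto
    define s :: real where "s = (- 1) ^ (r + 1)"
    define b where "b = s * bernoulli (2 * q)"
    have s: "\<bar>s\<bar> = 1" by (simp add: s_def)
    have mono: "s * bernpoly (2 * q) u \<le> s * bernpoly (2 * q) v"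
      if "0 \<le> u" "u \<le> v" "v \<le> 1 / 2" for u v
      using bernpoly_even_mono_from_odd[of s r u v] bernpoly_odd_sign[of _ r] that
      by (simp add: s_def r)
    define e :: real where "e = 2 / 2 ^ (2 * q)"
    have e: "0 \<le> e" "e \<le> 1"
      using assms(1) power_increasing[of 1 "2 * q" "2::real"] by (auto simp: e_def field_simps)
    have lo: "b \<le> s * bernpoly (2 * q) t"
      using mono[of 0 t] t by (simp add: b_def bernpoly_at_0)
    have hi: "s * bernpoly (2 * q) t \<le> (e - 1) * b"
      using mono[of t "1 / 2"] t by (simp add: b_def e_def bernpoly_half mult.left_commute)
    have "(2 - e) * b \<le> 0" using lo hi by (simp add: algebra_simps)
    then have "b \<le> 0" using e by (simp add: mult_le_0_iff)
    then have "e * b \<le> 0" using e by (simp add: mult_nonneg_nonpos)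
    then have "\<bar>s * bernpoly (2 * q) t\<bar> \<le> - b" using lo hi by (simp add: algebra_simps abs_le_iff)
    also have "- b = \<bar>b\<bar>" using \<open>b \<le> 0\<close> by simp
    finally show ?thesis using s by (simp add: b_def abs_mult)
  qed
  show ?thesis
  proof (cases "t \<le> 1 / 2")
    case False
    then show ?thesis using half[of "1 - t"] assms bernpoly_reflect[of "2 * q" t] by simp
  qed (use half assms in simp)
qed

section \<open>The Euler-Maclaurin formula on a subdivided unit interval\<close>

lemma frac_mult_on_cell:
  assumes "m \<ge> 1" "real j / real m \<le> t" "t < (real j + 1) / real m"
  shows "frac (real m * t) = real m * t - real j"
proof -
  have "real j \<le> real m * t" "real m * t < real j + 1"
    using assms by (simp_all add: field_simps)
  then have "\<lfloor>real m * t\<rfloor> = int j" by (simp add: floor_eq_iff)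
  then show ?thesis by (simp add: frac_def)
qed

text \<open>
  Repeated integration by parts is done in one step: the integrand has an explicit antiderivative \<open>A\<close>
  whose \<open>r\<close> summands have telescoping derivatives. The powers of \<open>c = -m\<close> collect the alternating signs
  and the chain rule factor \<open>m\<close>. The extra term with \<open>F 0 v\<close> comes from \<open>B\<^sub>1(1) = B\<^sub>1 + 1\<close>, the only index
  for which the two end values of the Bernoulli polynomial differ.
\<close>

lemma euler_maclaurin_cell:
  fixes F :: "nat \<Rightarrow> real \<Rightarrow> real" and m j r :: nat and x :: real
  defines "u \<equiv> x + real j / real m" and "v \<equiv> x + (real j + 1) / real m" and "c \<equiv> - real m"
  assumes "r \<ge> 1" "m \<ge> 1"
    and F: "\<And>k t. k < r \<Longrightarrow> u \<le> t \<Longrightarrow> t \<le> v \<Longrightarrow> (F k has_real_derivative F (Suc k) t) (at t)"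
  shows "((\<lambda>t. bernpoly r (frac (real m * t)) / fact r * F r (x + t) - c ^ r * F 0 (x + t))
    has_integral
      ((\<Sum>k=1..r. c ^ (r - k) * (bernoulli k / fact k) * (F (k - 1) v - F (k - 1) u))
        + c ^ (r - 1) * F 0 v)) {real j / real m..(real j + 1) / real m}"
proof -
  define A where
    "A t = (\<Sum>k=1..r. c ^ (r - k) * (bernpoly k (real m * t - real j) / fact k) * F (k - 1) (x + t))"
    for t
  define w where
    "w t k = c ^ (r - k) * (bernpoly k (real m * t - real j) / fact k) * F k (x + t)" for t k
  have le: "real j / real m \<le> (real j + 1) / real m"
    by (simp add: divide_right_mono)
  have A: "(A has_real_derivative
      bernpoly r (real m * t - real j) / fact r * F r (x + t) - c ^ r * F 0 (x + t)) (at t)"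
    if t: "real j / real m \<le> t" "t \<le> (real j + 1) / real m" for t
  proof -
    have "((\<lambda>t. c ^ (r - k) * (bernpoly k (real m * t - real j) / fact k) * F (k - 1) (x + t))
        has_real_derivative w t k - w t (k - 1)) (at t)" if k: "k \<in> {1..r}" for k
    proof -
      obtain k' where k': "k = Suc k'" using k by (cases k) auto
      have B: "((\<lambda>t. bernpoly k (real m * t - real j)) has_real_derivative
          real k * bernpoly k' (real m * t - real j) * real m) (at t)"
        unfolding k' by (rule DERIV_chain2[OF bernpoly_deriv]) (auto intro!: derivative_eq_intros)
      have "(F k' has_real_derivative F k (x + t)) (at (x + t))"
        unfolding k' using k k' t by (intro F) (auto simp: u_def v_def)
      then have D: "((\<lambda>t. F k' (x + t)) has_real_derivative F k (x + t) * 1) (at t)"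
        by (rule DERIV_chain2) (auto intro!: derivative_eq_intros)
      have pow: "c ^ (r - k') = - real m * c ^ (r - k)"
      proof -
        have "r - k' = Suc (r - k)" using k k' by auto
        then show ?thesis by (simp add: c_def)
      qed
      have fct: "real k / fact k = 1 / fact k'"
        unfolding k' fact_Suc by simp
      have "((\<lambda>t. c ^ (r - k) / fact k * (bernpoly k (real m * t - real j) * F k' (x + t)))
        has_real_derivative c ^ (r - k) / fact k *
          (real k * bernpoly k' (real m * t - real j) * real m * F k' (x + t)
            + F k (x + t) * 1 * bernpoly k (real m * t - real j))) (at t)"
        by (rule DERIV_cmult[OF DERIV_mult[OF B D]])
      moreover have "c ^ (r - k) / fact k *
          (real k * bernpoly k' (real m * t - real j) * real m * F k' (x + t)
            + F k (x + t) * 1 * bernpoly k (real m * t - real j))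
          = w t k + (real k / fact k) * (c ^ (r - k) * real m) *
              bernpoly k' (real m * t - real j) * F k' (x + t)"
        by (simp add: w_def algebra_simps add_divide_distrib)
      moreover have "w t (k - 1) = - ((real k / fact k) * (c ^ (r - k) * real m) *
              bernpoly k' (real m * t - real j) * F k' (x + t))"
        unfolding fct by (simp add: w_def k' pow[unfolded k'])
      ultimately show ?thesis
        by (simp add: k' mult.assoc)
    qed
    then have "(A has_real_derivative (\<Sum>k=1..r. w t k - w t (k - 1))) (at t)"
      unfolding A_def by (rule DERIV_sum)
    also have "(\<Sum>k=1..r. w t k - w t (k - 1)) = w t r - w t 0"
      using sum_telescope''[of 0 r "w t"] by simp
    finally show ?thesis by (simp add: w_def)
  qed
  have "((\<lambda>t. bernpoly r (real m * t - real j) / fact r * F r (x + t) - c ^ r * F 0 (x + t))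
      has_integral (A ((real j + 1) / real m) - A (real j / real m)))
      {real j / real m..(real j + 1) / real m}"
    using A by (intro fundamental_theorem_of_calculus le)
      (auto simp: has_real_derivative_iff_has_vector_derivative[symmetric]
        intro: has_field_derivative_at_within)
  \<comment> \<open>Only at the right end of the cell does \<open>frac (m t)\<close> differ from \<open>m t - j\<close>.\<close>
  then have int: "((\<lambda>t. bernpoly r (frac (real m * t)) / fact r * F r (x + t) - c ^ r * F 0 (x + t))
      has_integral (A ((real j + 1) / real m) - A (real j / real m)))
      {real j / real m..(real j + 1) / real m}"
    by (rule has_integral_spike_finite[where S = "{(real j + 1) / real m}", rotated 2])
       (use \<open>m \<ge> 1\<close> in \<open>auto simp: frac_mult_on_cell\<close>)
  have "A ((real j + 1) / real m) - A (real j / real m) =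
      (\<Sum>k=1..r. c ^ (r - k) * (bernpoly k 1 / fact k) * F (k - 1) v
        - c ^ (r - k) * (bernoulli k / fact k) * F (k - 1) u)"
    unfolding A_def using \<open>m \<ge> 1\<close>
    by (simp add: u_def v_def sum_subtractf bernpoly_at_0)
  also have "\<dots> = (\<Sum>k=1..r. c ^ (r - k) * (bernoulli k / fact k) * (F (k - 1) v - F (k - 1) u)
      + (if k = 1 then c ^ (r - 1) * F 0 v else 0))"
    by (intro sum.cong refl) (simp add: bernpoly_at_1 algebra_simps)
  also have "\<dots> = (\<Sum>k=1..r. c ^ (r - k) * (bernoulli k / fact k) * (F (k - 1) v - F (k - 1) u))
      + c ^ (r - 1) * F 0 v"
    using \<open>r \<ge> 1\<close> by (simp add: sum.distrib)
  finally show ?thesis using int by simp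
qed

text \<open>
  Adding the cells, the differences of the \<open>F (k - 1)\<close> telescope to the ends of the unit interval. The
  terms \<open>F 0 v\<close> are the values at the right ends of the cells; passing to the left ends costs
  \<open>F 0 (x + 1) - F 0 x\<close>.
\<close>

lemma euler_maclaurin_unit_interval:
  fixes F :: "nat \<Rightarrow> real \<Rightarrow> real" and m r :: nat and x :: real
  assumes r: "r \<ge> 1" and m: "m \<ge> 1"
    and F: "\<And>k t. k < r \<Longrightarrow> x \<le> t \<Longrightarrow> t \<le> x + 1 \<Longrightarrow> (F k has_real_derivative F (Suc k) t) (at t)"
  defines "\<Phi> \<equiv> \<lambda>t. bernpoly r (frac (real m * t)) / fact r * F r (x + t)"
  shows "\<Phi> integrable_on {0..1}" (is ?int)
    and "1 / real m * (\<Sum>j<m. F 0 (x + real j / real m)) =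
      integral {x..x+1} (F 0) - 1 / real m * (F 0 (x + 1) - F 0 x)
      + (\<Sum>k=1..r. 1 / (- real m) ^ k * (bernoulli k / fact k) * (F (k - 1) (x + 1) - F (k - 1) x))
      - 1 / (- real m) ^ r * integral {0..1} \<Phi>" (is ?eq)
proof -
  define c where "c = - real m"
  have c: "c \<noteq> 0" using m by (simp add: c_def)
  define X where "X j = x + real j / real m" for j
  define cell where "cell j =
    (\<Sum>k=1..r. c ^ (r - k) * (bernoulli k / fact k) * (F (k - 1) (X (Suc j)) - F (k - 1) (X j)))
        + c ^ (r - 1) * F 0 (X (Suc j))" for j
  have X_Suc: "X (Suc j) = x + (real j + 1) / real m" for j
    by (simp add: X_def add.commute)
  have partial: "((\<lambda>t. \<Phi> t - c ^ r * F 0 (x + t)) has_integral (\<Sum>j<n. cell j)) {0..real n / real m}"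
    if "n \<le> m" for n
    using that
  proof (induction n)
    case 0
    then show ?case by (simp add: has_integral_refl)
  next
    case (Suc n)
    have "((\<lambda>t. \<Phi> t - c ^ r * F 0 (x + t)) has_integral cell n) {real n / real m..(real n + 1) / real m}"
      unfolding \<Phi>_def c_def cell_def X_Suc unfolding X_def
    proof (rule euler_maclaurin_cell[OF r m])
      fix k t assume k: "k < r" and t: "x + real n / real m \<le> t" "t \<le> x + (real n + 1) / real m"
      have "0 \<le> real n / real m" by simp
      moreover have "(real n + 1) / real m \<le> 1" using Suc.prems m by simp
      ultimately have "x \<le> t" "t \<le> x + 1" using t by linarith+
      then show "(F k has_real_derivative F (Suc k) t) (at t)" by (intro F k)
    qed
    then have "((\<lambda>t. \<Phi> t - c ^ r * F 0 (x + t)) has_integral ((\<Sum>j<n. cell j) + cell n))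
        {0..(real n + 1) / real m}"
      using Suc by (intro has_integral_combine[of 0 "real n / real m"]) (auto simp: divide_right_mono)
    then show ?case by (simp add: add.commute)
  qed
  have F0: "F 0 integrable_on {x..x+1}"
    using DERIV_isCont[OF F[of 0]] r
    by (intro integrable_continuous_real continuous_at_imp_continuous_on) auto
  define J where "J = integral {x..x+1} (F 0)"
  have J: "((\<lambda>t. c ^ r * F 0 (x + t)) has_integral c ^ r * J) {0..1}"
  proof (rule has_integral_mult_right)
    show "((\<lambda>t. F 0 (x + t)) has_integral J) {0..1}"
      using F0 has_integral_shift_Icc_real[of "F 0" x J 0 1]
      by (simp add: J_def comp_def has_integral_integral[symmetric] add.commute)
  qed
  have whole: "((\<lambda>t. \<Phi> t - c ^ r * F 0 (x + t)) has_integral (\<Sum>j<m. cell j)) {0..1}"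
    using partial[of m] m by simp
  have I: "(\<Phi> has_integral ((\<Sum>j<m. cell j) + c ^ r * J)) {0..1}"
    using has_integral_add[OF whole J] by simp
  then show ?int by blast
  define S where "S = (\<Sum>j<m. F 0 (X j))"
  define b where "b k = bernoulli k / fact k * (F (k - 1) (x + 1) - F (k - 1) x)" for k
  have Xm: "X m = x + 1" "X 0 = x" using m by (simp_all add: X_def)
  have shifted: "(\<Sum>j<m. F 0 (X (Suc j))) = S + (F 0 (x + 1) - F 0 x)"
    using sum_lessThan_telescope[of "\<lambda>j. F 0 (X j)" m]
    by (simp add: sum_subtractf S_def Xm)
  have telescoped: "(\<Sum>j<m. c ^ (r - k) * (bernoulli k / fact k) *
      (F (k - 1) (X (Suc j)) - F (k - 1) (X j))) = c ^ (r - k) * b k" for k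
    using sum_lessThan_telescope[of "\<lambda>j. F (k - 1) (X j)" m]
    by (simp only: sum_distrib_left[symmetric] b_def Xm mult.assoc)
  have "(\<Sum>j<m. cell j) =
      (\<Sum>k=1..r. \<Sum>j<m. c ^ (r - k) * (bernoulli k / fact k) * (F (k - 1) (X (Suc j)) - F (k - 1) (X j)))
      + c ^ (r - 1) * (\<Sum>j<m. F 0 (X (Suc j)))"
    unfolding cell_def by (subst sum.swap) (simp add: sum.distrib sum_distrib_left)
  also have "\<dots> = (\<Sum>k=1..r. c ^ (r - k) * b k) + c ^ (r - 1) * (S + (F 0 (x + 1) - F 0 x))"
    by (simp only: telescoped shifted)
  finally have "integral {0..1} \<Phi> =
      (\<Sum>k=1..r. c ^ (r - k) * b k) + c ^ (r - 1) * (S + (F 0 (x + 1) - F 0 x)) + c ^ r * J"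
    using integral_unique[OF I] by simp
  then have "1 / c ^ r * integral {0..1} \<Phi> =
      (\<Sum>k=1..r. 1 / c ^ r * (c ^ (r - k) * b k))
      + 1 / c ^ r * c ^ (r - 1) * (S + (F 0 (x + 1) - F 0 x)) + 1 / c ^ r * c ^ r * J"
    by (simp only: distrib_left sum_distrib_left mult.assoc)
  also have "(\<Sum>k=1..r. 1 / c ^ r * (c ^ (r - k) * b k)) = (\<Sum>k=1..r. 1 / c ^ k * b k)"
    using c by (intro sum.cong refl) (auto simp: power_diff)
  also have "1 / c ^ r * c ^ (r - 1) = 1 / c"
    using c r by (cases r) auto
  also have "1 / c ^ r * c ^ r = 1" using c by simp
  finally have "1 / c ^ r * integral {0..1} \<Phi> =
      (\<Sum>k=1..r. 1 / c ^ k * b k) - 1 / real m * (S + (F 0 (x + 1) - F 0 x)) + J"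
    by (simp add: c_def)
  then show ?eq
    by (simp add: c_def S_def X_def J_def b_def algebra_simps)
qed

lemma euler_maclaurin_remainder_bound:
  fixes F :: "real \<Rightarrow> real" and m r :: nat and x K :: real
  assumes B: "\<And>t. 0 \<le> t \<Longrightarrow> t \<le> 1 \<Longrightarrow> \<bar>bernpoly r t\<bar> \<le> K"
    and F: "continuous_on {x..x+1} F"
    and int: "(\<lambda>t. bernpoly r (frac (real m * t)) / fact r * F (x + t)) integrable_on {0..1}"
  shows "\<bar>integral {0..1} (\<lambda>t. bernpoly r (frac (real m * t)) / fact r * F (x + t))\<bar>
    \<le> K / fact r * integral {0..1} (\<lambda>t. \<bar>F (x + t)\<bar>)"
proof -
  have cont: "continuous_on {0..1} (\<lambda>t. F (x + t))"
    by (rule continuous_on_compose2[OF F]) (auto intro!: continuous_intros)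
  have "norm (integral {0..1} (\<lambda>t. bernpoly r (frac (real m * t)) / fact r * F (x + t)))
      \<le> integral {0..1} (\<lambda>t. K / fact r * \<bar>F (x + t)\<bar>)"
  proof (rule integral_norm_bound_integral[OF int])
    show "(\<lambda>t. K / fact r * \<bar>F (x + t)\<bar>) integrable_on {0..1}"
      by (intro integrable_continuous_real continuous_intros cont)
    fix t :: real
    have "\<bar>bernpoly r (frac (real m * t))\<bar> / fact r * \<bar>F (x + t)\<bar> \<le> K / fact r * \<bar>F (x + t)\<bar>"
      by (intro mult_right_mono divide_right_mono B) (auto intro: less_imp_le frac_lt_1)
    then show "norm (bernpoly r (frac (real m * t)) / fact r * F (x + t)) \<le> K / fact r * \<bar>F (x + t)\<bar>"
      by (simp add: abs_mult)
  qed
  then show ?thesis by simp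
qed

lemma integral_abs_deriv_constant_sign:
  fixes F F' :: "real \<Rightarrow> real"
  assumes F: "\<And>t. x \<le> t \<Longrightarrow> t \<le> x + 1 \<Longrightarrow> (F has_real_derivative F' t) (at t)"
    and s: "\<bar>s\<bar> = 1" "\<And>t. x \<le> t \<Longrightarrow> t \<le> x + 1 \<Longrightarrow> 0 \<le> s * F' t"
  shows "integral {0..1} (\<lambda>t. \<bar>F' (x + t)\<bar>) = \<bar>F (x + 1) - F x\<bar>"
proof -
  have "((\<lambda>t. s * F (x + t)) has_real_derivative s * F' (x + t)) (at t)" if "0 \<le> t" "t \<le> 1" for t
    using DERIV_cmult[OF DERIV_shift[THEN iffD1], of F "F' (x + t)" t x s] F[of "x + t"] that
    by (simp add: add.commute)
  then have "((\<lambda>t. s * F' (x + t)) has_integral (s * F (x + 1) - s * F (x + 0))) {0..1}"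
    by (intro fundamental_theorem_of_calculus)
       (auto simp: has_real_derivative_iff_has_vector_derivative[symmetric]
         intro: has_field_derivative_at_within)
  moreover have "s * F' (x + t) = \<bar>F' (x + t)\<bar>" if "t \<in> {0..1}" for t
    using s(2)[of "x + t"] s(1) that abs_of_nonneg[of "s * F' (x + t)"] by (simp add: abs_mult)
  ultimately have "((\<lambda>t. \<bar>F' (x + t)\<bar>) has_integral (s * F (x + 1) - s * F (x + 0))) {0..1}"
    by (rule has_integral_eq[rotated])
  then have int: "((\<lambda>t. \<bar>F' (x + t)\<bar>) has_integral (s * (F (x + 1) - F x))) {0..1}"
    by (simp add: right_diff_distrib)
  then have "0 \<le> s * (F (x + 1) - F x)"
    by (rule has_integral_nonneg) simp
  then have "s * (F (x + 1) - F x) = \<bar>F (x + 1) - F x\<bar>"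
    using s(1) abs_of_nonneg[of "s * (F (x + 1) - F x)"] by (simp add: abs_mult)
  then show ?thesis using int by (simp add: integral_unique)
qed

section \<open>The analogue of the Gauss multiplication formula\<close>

text \<open>
  Since \<open>D_class\<close> grows with its index, the locale applies with \<open>max p r\<close> in place of \<open>p\<close>.
\<close>

lemma Sigma_fun_regularity:
  assumes "g \<in> C_class r \<inter> D_class p \<inter> K_class (max p r)"
  shows "Sigma_fun g \<in> C_class r"
    and "\<And>k x. k \<le> r \<Longrightarrow> 0 < x \<Longrightarrow>
      (deriv ^^ k) (Sigma_fun g) (x + 1) - (deriv ^^ k) (Sigma_fun g) x = (deriv ^^ k) g x"
    and "\<exists>s b. \<bar>s\<bar> = 1 \<and> 0 < b \<and> (\<forall>x\<ge>b. 0 \<le> s * (deriv ^^ r) (Sigma_fun g) x)"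
proof -
  from assms have "g \<in> K_class (max p r)" by simp
  then obtain s a where "\<bar>s\<bar> = 1" "a > 0" "dd_sign s (max p r + 2) {a..} g"
    by (rule K_class_imp_dd_sign)
  moreover have "g \<in> D_class (max p r)"
    using assms by (auto intro: D_class_mono[of g p "max p r"])
  ultimately interpret admissible_summand g r "max p r" s a
    using assms by unfold_locales auto
  show "Sigma_fun g \<in> C_class r"
    by (rule Sigma_fun_in_C_class)
  show "\<And>k x. k \<le> r \<Longrightarrow> 0 < x \<Longrightarrow>
      (deriv ^^ k) (Sigma_fun g) (x + 1) - (deriv ^^ k) (Sigma_fun g) x = (deriv ^^ k) g x"
    by (rule Sigma_fun_deriv_step)
  show "\<exists>s b. \<bar>s\<bar> = 1 \<and> 0 < b \<and> (\<forall>x\<ge>b. 0 \<le> s * (deriv ^^ r) (Sigma_fun g) x)"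
    by (rule Sigma_fun_deriv_eventually_constant_sign)
qed

text \<open>
  This is the Euler-Maclaurin formula for \<open>Sigma_fun g\<close>, in which the differences over the unit
  interval are the derivatives of \<open>g\<close>. Both parts of the main result are instances: \<open>r = 1\<close>, where the
  bound on the Bernoulli polynomial is \<open>1/2\<close>, and \<open>r = 2 q\<close>, where it is \<open>\<bar>B\<^sub>2\<^sub>q\<bar>\<close>.
\<close>

lemma Sigma_fun_multiplication:
  fixes m :: nat and x K :: real
  assumes g: "g \<in> C_class r \<inter> D_class p \<inter> K_class (max p r)"
    and r: "r \<ge> 1" and m: "m \<ge> 1" and x: "x > 0"
    and K: "\<And>t. 0 \<le> t \<Longrightarrow> t \<le> 1 \<Longrightarrow> \<bar>bernpoly r t\<bar> \<le> K"
  defines "I \<equiv> integral {0..1}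
    (\<lambda>t. bernpoly r (frac (real m * t)) / fact r * (deriv ^^ r) (Sigma_fun g) (x + t))"
  shows "1 / real m * (\<Sum>j=0..<m. Sigma_fun g (x + real j / real m)) =
      integral {x..x+1} (Sigma_fun g) - 1 / real m * g x
      + (\<Sum>k=1..r. 1 / (- real m) ^ k * (bernoulli k / fact k) * (deriv ^^ (k - 1)) g x)
      - 1 / (- real m) ^ r * I"
    and "\<bar>I\<bar> \<le> K / fact r * integral {0..1} (\<lambda>t. \<bar>(deriv ^^ r) (Sigma_fun g) (x + t)\<bar>)"
proof -
  define F where "F k = (deriv ^^ k) (Sigma_fun g)" for k
  have C: "Sigma_fun g \<in> C_class r" by (rule Sigma_fun_regularity(1)[OF g])
  have F: "(F k has_real_derivative F (Suc k) t) (at t)" if "k < r" "x \<le> t" "t \<le> x + 1" for k t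
    using C that x unfolding C_class_iff F_def by auto
  have F_cont: "continuous_on {x..x+1} (F r)"
    using C x unfolding C_class_iff F_def by (auto elim: continuous_on_subset)
  have step: "F k (x + 1) - F k x = (deriv ^^ k) g x" if "k \<le> r" for k
    unfolding F_def using that x by (rule Sigma_fun_regularity(2)[OF g])
  note EM = euler_maclaurin_unit_interval[of r m x F, OF r m F]
  have "(\<Sum>k=1..r. 1 / (- real m) ^ k * (bernoulli k / fact k) * (F (k - 1) (x + 1) - F (k - 1) x))
      = (\<Sum>k=1..r. 1 / (- real m) ^ k * (bernoulli k / fact k) * (deriv ^^ (k - 1)) g x)"
    by (intro sum.cong arg_cong2[where f = "(*)"] refl step) auto
  then show "1 / real m * (\<Sum>j=0..<m. Sigma_fun g (x + real j / real m)) =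
      integral {x..x+1} (Sigma_fun g) - 1 / real m * g x
      + (\<Sum>k=1..r. 1 / (- real m) ^ k * (bernoulli k / fact k) * (deriv ^^ (k - 1)) g x)
      - 1 / (- real m) ^ r * I"
    using EM(2) step[of 0] by (simp add: F_def I_def lessThan_atLeast0)
  show "\<bar>I\<bar> \<le> K / fact r * integral {0..1} (\<lambda>t. \<bar>(deriv ^^ r) (Sigma_fun g) (x + t)\<bar>)"
    using euler_maclaurin_remainder_bound[OF K F_cont EM(1)] by (simp add: F_def I_def)
qed

lemma eventually_integral_abs_Sigma_fun_deriv:
  assumes g: "g \<in> C_class r \<inter> D_class p \<inter> K_class (max p r)" and r: "r \<ge> 1"
  shows "\<forall>\<^sub>F x in at_top. integral {0..1} (\<lambda>t. \<bar>(deriv ^^ r) (Sigma_fun g) (x + t)\<bar>) =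
    \<bar>(deriv ^^ (r - 1)) g x\<bar>"
proof -
  obtain s b where s: "\<bar>s\<bar> = 1" and b: "0 < b"
    and sign: "\<And>x. x \<ge> b \<Longrightarrow> 0 \<le> s * (deriv ^^ r) (Sigma_fun g) x"
    using Sigma_fun_regularity(3)[OF g] by blast
  have "integral {0..1} (\<lambda>t. \<bar>(deriv ^^ r) (Sigma_fun g) (x + t)\<bar>) = \<bar>(deriv ^^ (r - 1)) g x\<bar>"
    if x: "b \<le> x" for x
  proof -
    obtain k where k: "r = Suc k" using r by (cases r) auto
    have "((deriv ^^ k) (Sigma_fun g) has_real_derivative (deriv ^^ r) (Sigma_fun g) t) (at t)"
      if "x \<le> t" for t
      using Sigma_fun_regularity(1)[OF g] that x b unfolding C_class_iff k by auto
    from integral_abs_deriv_constant_sign[OF this s, of x] have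
      "integral {0..1} (\<lambda>t. \<bar>(deriv ^^ r) (Sigma_fun g) (x + t)\<bar>) =
        \<bar>(deriv ^^ k) (Sigma_fun g) (x + 1) - (deriv ^^ k) (Sigma_fun g) x\<bar>"
      using sign x by simp
    then show ?thesis using Sigma_fun_regularity(2)[OF g, of k x] x b by (simp add: k)
  qed
  then show ?thesis unfolding eventually_at_top_linorder by blast
qed

lemma sum_even_of_odd_zero:
  fixes h :: "nat \<Rightarrow> real"
  assumes "q \<ge> 1" "\<And>k. odd k \<Longrightarrow> k \<noteq> 1 \<Longrightarrow> h k = 0"
  shows "(\<Sum>k=1..2*q. h k) = h 1 + (\<Sum>k=1..q. h (2 * k))"
  using assms(1)
proof (induction q rule: dec_induct)
  case base
  then show ?case by (simp add: numeral_2_eq_2)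
next
  case (step q)
  have "h (Suc (2 * q)) = 0" using step.hyps by (intro assms(2)) auto
  then show ?case using step.IH by simp
qed

theorem proposition8p35:
  fixes g :: "real \<Rightarrow> real" and p :: nat
  shows
    "(g \<in> C_class 1 \<inter> D_class p \<inter> K_class (max p 1) \<longrightarrow>
       (\<forall>m::nat. \<forall>x::real. m \<ge> 1 \<and> x > 0 \<longrightarrow>
          (let R = 1 / real m *
                 integral {0..1} (\<lambda>t. bernpoly 1 (frac (real m * t)) * deriv (Sigma_fun g) (x + t))
           in 1 / real m * (\<Sum>j=0..<m. Sigma_fun g (x + real j / real m)) =
                integral {x..x+1} (Sigma_fun g) - 1 / (2 * real m) * g x + R \<and>
              \<bar>R\<bar> \<le> 1 / (2 * real m) * integral {0..1} (\<lambda>t. \<bar>deriv (Sigma_fun g) (x + t)\<bar>))) \<and>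
       (\<forall>\<^sub>F x in at_top. integral {0..1} (\<lambda>t. \<bar>deriv (Sigma_fun g) (x + t)\<bar>) = \<bar>g x\<bar>))
     \<and>
     (\<forall>q::nat. q \<ge> 1 \<and> g \<in> C_class (2 * q) \<inter> D_class p \<inter> K_class (max p (2 * q)) \<longrightarrow>
       (\<forall>m::nat. \<forall>x::real. m \<ge> 1 \<and> x > 0 \<longrightarrow>
          (let R = - (1 / real m ^ (2 * q)) *
                 integral {0..1} (\<lambda>t. bernpoly (2 * q) (frac (real m * t)) / fact (2 * q) *
                                      (deriv ^^ (2 * q)) (Sigma_fun g) (x + t))
           in 1 / real m * (\<Sum>j=0..<m. Sigma_fun g (x + real j / real m)) =
                integral {x..x+1} (Sigma_fun g) - 1 / (2 * real m) * g x
                + (\<Sum>k=1..q. 1 / real m ^ (2 * k) * (bernoulli (2 * k) / fact (2 * k)) *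
                              (deriv ^^ (2 * k - 1)) g x) + R \<and>
              \<bar>R\<bar> \<le> 1 / real m ^ (2 * q) * (\<bar>bernoulli (2 * q)\<bar> / fact (2 * q)) *
                     integral {0..1} (\<lambda>t. \<bar>(deriv ^^ (2 * q)) (Sigma_fun g) (x + t)\<bar>))) \<and>
       (\<forall>\<^sub>F x in at_top. integral {0..1} (\<lambda>t. \<bar>(deriv ^^ (2 * q)) (Sigma_fun g) (x + t)\<bar>) =
                          \<bar>(deriv ^^ (2 * q - 1)) g x\<bar>))"
proof (intro conjI impI allI; (elim conjE)?)
  assume g: "g \<in> C_class 1 \<inter> D_class p \<inter> K_class (max p 1)"
  show "\<forall>\<^sub>F x in at_top. integral {0..1} (\<lambda>t. \<bar>deriv (Sigma_fun g) (x + t)\<bar>) = \<bar>g x\<bar>"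
    using eventually_integral_abs_Sigma_fun_deriv[OF g] by simp
  fix m :: nat and x :: real assume m: "m \<ge> 1" and x: "x > 0"
  define I where
    "I = integral {0..1} (\<lambda>t. bernpoly 1 (frac (real m * t)) * deriv (Sigma_fun g) (x + t))"
  define J where "J = integral {0..1} (\<lambda>t. \<bar>deriv (Sigma_fun g) (x + t)\<bar>)"
  have "\<bar>bernpoly 1 t\<bar> \<le> 1 / 2" if "0 \<le> t" "t \<le> 1" for t
    using that unfolding bernpoly_1 abs_le_iff by simp
  note EM = Sigma_fun_multiplication[OF g order_refl m x this]
  have "1 / real m * (\<Sum>j=0..<m. Sigma_fun g (x + real j / real m)) =
      integral {x..x+1} (Sigma_fun g) - 1 / (2 * real m) * g x + 1 / real m * I"
    using EM(1) by (simp add: I_def)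
  moreover have "\<bar>I\<bar> \<le> 1 / 2 * J" using EM(2) by (simp add: I_def J_def)
  then have "1 / real m * \<bar>I\<bar> \<le> 1 / real m * (1 / 2 * J)"
    by (rule mult_left_mono) simp
  then have "\<bar>1 / real m * I\<bar> \<le> 1 / (2 * real m) * J" by (simp add: abs_mult)
  ultimately show "let R = 1 / real m *
         integral {0..1} (\<lambda>t. bernpoly 1 (frac (real m * t)) * deriv (Sigma_fun g) (x + t))
      in 1 / real m * (\<Sum>j=0..<m. Sigma_fun g (x + real j / real m)) =
           integral {x..x+1} (Sigma_fun g) - 1 / (2 * real m) * g x + R \<and>
         \<bar>R\<bar> \<le> 1 / (2 * real m) * integral {0..1} (\<lambda>t. \<bar>deriv (Sigma_fun g) (x + t)\<bar>)"
    unfolding Let_def I_def[symmetric] J_def[symmetric] by (rule conjI)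
next
  fix q :: nat
  assume q: "q \<ge> 1" and g: "g \<in> C_class (2 * q) \<inter> D_class p \<inter> K_class (max p (2 * q))"
  have q2: "2 * q \<ge> 1" using q by simp
  show "\<forall>\<^sub>F x in at_top. integral {0..1} (\<lambda>t. \<bar>(deriv ^^ (2 * q)) (Sigma_fun g) (x + t)\<bar>) =
      \<bar>(deriv ^^ (2 * q - 1)) g x\<bar>"
    by (rule eventually_integral_abs_Sigma_fun_deriv[OF g q2])
  fix m :: nat and x :: real assume m: "m \<ge> 1" and x: "x > 0"
  define I where
    "I = integral {0..1} (\<lambda>t. bernpoly (2 * q) (frac (real m * t)) / fact (2 * q) *
      (deriv ^^ (2 * q)) (Sigma_fun g) (x + t))"
  define J where "J = integral {0..1} (\<lambda>t. \<bar>(deriv ^^ (2 * q)) (Sigma_fun g) (x + t)\<bar>)"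
  note EM = Sigma_fun_multiplication[OF g q2 m x abs_bernpoly_even_le[OF q]]
  have "(\<Sum>k=1..2*q. 1 / (- real m) ^ k * (bernoulli k / fact k) * (deriv ^^ (k - 1)) g x)
      = 1 / (2 * real m) * g x + (\<Sum>k=1..q. 1 / real m ^ (2 * k) * (bernoulli (2 * k) / fact (2 * k)) *
          (deriv ^^ (2 * k - 1)) g x)"
    by (subst sum_even_of_odd_zero[OF q]) (simp_all add: bernoulli_odd_eq_0)
  then have "1 / real m * (\<Sum>j=0..<m. Sigma_fun g (x + real j / real m)) =
      integral {x..x+1} (Sigma_fun g) - 1 / (2 * real m) * g x
      + (\<Sum>k=1..q. 1 / real m ^ (2 * k) * (bernoulli (2 * k) / fact (2 * k)) *
          (deriv ^^ (2 * k - 1)) g x) + - (1 / real m ^ (2 * q)) * I"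
    using EM(1) by (simp add: I_def)
  moreover have "\<bar>I\<bar> \<le> \<bar>bernoulli (2 * q)\<bar> / fact (2 * q) * J"
    using EM(2) by (simp only: I_def J_def)
  then have "1 / real m ^ (2 * q) * \<bar>I\<bar> \<le> 1 / real m ^ (2 * q) * (\<bar>bernoulli (2 * q)\<bar> / fact (2 * q) * J)"
    by (rule mult_left_mono) simp
  then have "\<bar>- (1 / real m ^ (2 * q)) * I\<bar> \<le>
      1 / real m ^ (2 * q) * (\<bar>bernoulli (2 * q)\<bar> / fact (2 * q)) * J"
    by (simp add: abs_mult)
  ultimately show "let R = - (1 / real m ^ (2 * q)) *
         integral {0..1} (\<lambda>t. bernpoly (2 * q) (frac (real m * t)) / fact (2 * q) *
                              (deriv ^^ (2 * q)) (Sigma_fun g) (x + t))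
      in 1 / real m * (\<Sum>j=0..<m. Sigma_fun g (x + real j / real m)) =
           integral {x..x+1} (Sigma_fun g) - 1 / (2 * real m) * g x
           + (\<Sum>k=1..q. 1 / real m ^ (2 * k) * (bernoulli (2 * k) / fact (2 * k)) *
                         (deriv ^^ (2 * k - 1)) g x) + R \<and>
         \<bar>R\<bar> \<le> 1 / real m ^ (2 * q) * (\<bar>bernoulli (2 * q)\<bar> / fact (2 * q)) *
                integral {0..1} (\<lambda>t. \<bar>(deriv ^^ (2 * q)) (Sigma_fun g) (x + t)\<bar>)"
    unfolding Let_def I_def[symmetric] J_def[symmetric] by (rule conjI)
qed

end
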